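(* Let $\mathcal C$, $\mathcal D$ be $k$-linear pivotal monoidal categories over a field $k$, and let $\mathcal F\colon\mathcal C\to\mathcal D$ be a $k$-linear monoidal equivalence that preserves the pivotal structure. Assume that $\mathcal C(I,V)$ and $\mathcal D(I,W)$ are finite-dimensional for all objects $V$ in $\mathcal C$ and $W$ in $\mathcal D$. Then $$\nu_{n,r}(V)=\nu_{n,r}(\mathcal F(V))$$ for any object $V$ in $\mathcal C$ and all positive integers $n,r$.
   Context: Conventions. In a monoidal category the associativity isomorphism is $\Phi\colon (U\otimes V)\otimes W\to U\otimes (V\otimes W)$ and the unit object $I$ is strict: $V\otimes I=V=I\otimes V$. An object also denotes its identity morphism; $\mathcal C(X,Y)$ is the set of morphisms. In $k$-linear monoidal categories the tensor product is bilinear. A (left) dual of $V$ is $(V^\vee,\mathrm{ev}_V\colon V^\vee\otimes V\to I,\mathrm{db}_V\colon I\to V\otimes V^\vee)$ with $(V\otimes \mathrm{ev}_V)\Phi(\mathrm{db}_V\otimes V)=\mathrm{id}_V$ and $(\mathrm{ev}_V\otimes V^\vee)\Phi^{-1}(V^\vee\otimes\mathrm{db}_V)=\mathrm{id}_{V^\vee}$. A category is rigid if all left duals exist; a choice is fixed with $I^\vee=I$ (and identity $\mathrm{ev}_I$, $\mathrm{db}_I$). Then $(-)^\vee$ is a contravariant functor, with $f^\vee$ for $f\colon V\to W$ determined by $\mathrm{ev}_V(f^\vee\otimes V)=\mathrm{ev}_W(W^\vee\otimes f)$, and $(-)^{\vee\vee}$ is canonically a monoidal functor (via the canonical isomorphisms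 $W^\vee\otimes V^\vee\cong(V\otimes W)^\vee$ given by uniqueness of duals). A pivotal monoidal category is a rigid monoidal category with a pivotal structure: a monoidal natural isomorphism $j_V\colon V\to V^{\vee\vee}$. A monoidal functor $(\mathcal F,\xi)\colon\mathcal C\to\mathcal D$ has coherent natural isomorphisms $\xi\colon\mathcal F(V)\otimes\mathcal F(W)\to\mathcal F(V\otimes W)$ and $\mathcal F(I)=I$ with identity unit structure. Its duality transformation $\tilde\xi_X\colon\mathcal F(X^\vee)\to\mathcal F(X)^\vee$ is the isomorphism determined by $\mathrm{ev}_{\mathcal F(X)}(\tilde\xi_X\otimes\mathcal F(X))=\mathcal F(\mathrm{ev}_X)\xi$. $\mathcal F$ preserves the pivotal structure if $\tilde\xi_{X^\vee}\mathcal F(j_X)=(\tilde\xi_X)^\vee j_{\mathcal F(X)}$ for all $X$. Indicators. Put $V^{\otimes 0}=I$, $V^{\otimes(n+1)}=V\otimes V^{\otimes n}$, and let $\Phi^{(n)}\colon V^{\otimes(n-1)}\otimes V\to V^{\otimes n}$ be the canonical associativity isomorphism ($\Phi^{(1)}=\mathrm{id}$, $\Phi^{(n+1)}=(V\otimes\Phi^{(n)})\Phi$). Let $A=A_{V,W}\colon\mathcal C(I,V\otimes W)\to\mathcal C(V^\vee,W)$ be the bijection $A(f)=(\mathrm{ev}_V\otimes W)\Phi^{-1}(V^\vee\otimes f)$, with inverse $A^{-1}(g)=(V\otimes g)\mathrm{db}_V$. Let $T_{VW}\colon\mathcal C(V^\vee,W)\to\mathcal C(W^\vee,V)$, $T_{VW}(f)=j_V^{-1}f^\vee$.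 Put $E_{VW}=A_{W,V}^{-1}\,T_{VW}\,A_{V,W}\colon\mathcal C(I,V\otimes W)\to\mathcal C(I,W\otimes V)$ and, for $n\ge1$, $E_V^{(n)}\colon\mathcal C(I,V^{\otimes n})\to\mathcal C(I,V^{\otimes n})$, $E_V^{(n)}(f)=\Phi^{(n)}E_{V,V^{\otimes(n-1)}}(f)$. For positive integers $n,r$ the $(n,r)$-th Frobenius-Schur indicator is $\nu_{n,r}(V)=\mathrm{Tr}\big((E_V^{(n)})^r\big)\in k$. *)

theory Defs
  imports "Jordan_Normal_Form.Missing_VectorSpace"
begin

section \<open>Categories\<close>

record ('o, 'm) cat =
  Obj :: "'o set"
  Arr :: "'m set"
  Dom :: "'m \<Rightarrow> 'o"
  Cod :: "'m \<Rightarrow> 'o"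
  Ident :: "'o \<Rightarrow> 'm"
  Comp :: "'m \<Rightarrow> 'm \<Rightarrow> 'm"  (infixr "\<cdot>\<index>" 65)

definition Hom :: "('o, 'm, 'z) cat_scheme \<Rightarrow> 'o \<Rightarrow> 'o \<Rightarrow> 'm set" where
  "Hom C X Y = {f \<in> Arr C. Dom C f = X \<and> Cod C f = Y}"

locale category =
  fixes C :: "('o, 'm, 'z) cat_scheme" (structure)
  assumes Dom_in_Obj: "f \<in> Arr C \<Longrightarrow> Dom C f \<in> Obj C"
    and Cod_in_Obj: "f \<in> Arr C \<Longrightarrow> Cod C f \<in> Obj C"
    and Ident_in_Hom: "X \<in> Obj C \<Longrightarrow> Ident C X \<in> Hom C X X"
    and Comp_in_Hom: "\<lbrakk>f \<in> Hom C X Y; g \<in> Hom C Y Z\<rbrakk> \<Longrightarrow> g \<cdot> f \<in> Hom C X Z"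
    and Comp_Ident_left: "f \<in> Hom C X Y \<Longrightarrow> Ident C Y \<cdot> f = f"
    and Comp_Ident_right: "f \<in> Hom C X Y \<Longrightarrow> f \<cdot> Ident C X = f"
    and Comp_assoc: "\<lbrakk>f \<in> Hom C W X; g \<in> Hom C X Y; h \<in> Hom C Y Z\<rbrakk>
      \<Longrightarrow> (h \<cdot> g) \<cdot> f = h \<cdot> (g \<cdot> f)"

definition inverse_arrows :: "('o, 'm, 'z) cat_scheme \<Rightarrow> 'm \<Rightarrow> 'm \<Rightarrow> bool" where
  "inverse_arrows C f g \<longleftrightarrow> f \<in> Arr C \<and> g \<in> Hom C (Cod C f) (Dom C f)
     \<and> g \<cdot>\<^bsub>C\<^esub> f = Ident C (Dom C f) \<and> f \<cdot>\<^bsub>C\<^esub> g = Ident C (Cod C f)"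

definition iso_arr :: "('o, 'm, 'z) cat_scheme \<Rightarrow> 'm \<Rightarrow> bool" where
  "iso_arr C f \<longleftrightarrow> (\<exists>g. inverse_arrows C f g)"

definition inv_arr :: "('o, 'm, 'z) cat_scheme \<Rightarrow> 'm \<Rightarrow> 'm" where
  "inv_arr C f = (THE g. inverse_arrows C f g)"

definition is_functor ::
  "('o1, 'm1, 'z1) cat_scheme \<Rightarrow> ('o2, 'm2, 'z2) cat_scheme
     \<Rightarrow> ('o1 \<Rightarrow> 'o2) \<Rightarrow> ('m1 \<Rightarrow> 'm2) \<Rightarrow> bool" where
  "is_functor C D Fo Fa \<longleftrightarrow>
     (\<forall>X \<in> Obj C. Fo X \<in> Obj D \<and> Fa (Ident C X) = Ident D (Fo X))
     \<and> (\<forall>X Y. \<forall>f \<in> Hom C X Y. Fa f \<in> Hom D (Fo X) (Fo Y))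
     \<and> (\<forall>X Y Z. \<forall>f \<in> Hom C X Y. \<forall>g \<in> Hom C Y Z. Fa (g \<cdot>\<^bsub>C\<^esub> f) = Fa g \<cdot>\<^bsub>D\<^esub> Fa f)"

definition natural_iso ::
  "('o1, 'm1, 'z1) cat_scheme \<Rightarrow> ('o2, 'm2, 'z2) cat_scheme
     \<Rightarrow> ('o1 \<Rightarrow> 'o2) \<Rightarrow> ('m1 \<Rightarrow> 'm2) \<Rightarrow> ('o1 \<Rightarrow> 'o2) \<Rightarrow> ('m1 \<Rightarrow> 'm2)
     \<Rightarrow> ('o1 \<Rightarrow> 'm2) \<Rightarrow> bool" where
  "natural_iso C D Fo Fa Go Ga \<tau> \<longleftrightarrow>
     (\<forall>X \<in> Obj C. \<tau> X \<in> Hom D (Fo X) (Go X) \<and> iso_arr D (\<tau> X))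
     \<and> (\<forall>X Y. \<forall>f \<in> Hom C X Y. \<tau> Y \<cdot>\<^bsub>D\<^esub> Fa f = Ga f \<cdot>\<^bsub>D\<^esub> \<tau> X)"

definition is_equivalence ::
  "('o1, 'm1, 'z1) cat_scheme \<Rightarrow> ('o2, 'm2, 'z2) cat_scheme
     \<Rightarrow> ('o1 \<Rightarrow> 'o2) \<Rightarrow> ('m1 \<Rightarrow> 'm2) \<Rightarrow> bool" where
  "is_equivalence C D Fo Fa \<longleftrightarrow> is_functor C D Fo Fa
     \<and> (\<exists>Go Ga \<eta> \<epsilon>. is_functor D C Go Ga
          \<and> natural_iso C C (\<lambda>X. X) (\<lambda>f. f) (Go \<circ> Fo) (Ga \<circ> Fa) \<eta>
          \<and> natural_iso D D (Fo \<circ> Go) (Fa \<circ> Ga) (\<lambda>X. X) (\<lambda>f. f) \<epsilon>)"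


section \<open>Monoidal categories with strict unit\<close>

record ('o, 'm) monoidal_cat = "('o, 'm) cat" +
  Unit :: "'o"
  TensorObj :: "'o \<Rightarrow> 'o \<Rightarrow> 'o"  (infixl "\<boxtimes>\<index>" 75)
  TensorArr :: "'m \<Rightarrow> 'm \<Rightarrow> 'm"  (infixl "\<star>\<index>" 75)
  Assoc :: "'o \<Rightarrow> 'o \<Rightarrow> 'o \<Rightarrow> 'm"  ("\<Phi>\<index>")

text \<open>
  Strictness of the unit object means that both unit isomorphisms are identities: this comprises
  the equalities of objects, naturality of the unit isomorphisms (equalities of arrows), and the
  triangle axiom, which then reads \<open>\<Phi> V I W = id\<close>.
\<close>

locale monoidal_category = category C
  for C :: "('o, 'm, 'z) monoidal_cat_scheme" (structure) +
  assumes Unit_in_Obj: "Unit C \<in> Obj C"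
    and Tensor_in_Obj: "\<lbrakk>V \<in> Obj C; W \<in> Obj C\<rbrakk> \<Longrightarrow> V \<boxtimes> W \<in> Obj C"
    and Tensor_in_Hom: "\<lbrakk>f \<in> Hom C V V'; g \<in> Hom C W W'\<rbrakk>
      \<Longrightarrow> f \<star> g \<in> Hom C (V \<boxtimes> W) (V' \<boxtimes> W')"
    and Tensor_Ident: "\<lbrakk>V \<in> Obj C; W \<in> Obj C\<rbrakk> \<Longrightarrow> Ident C V \<star> Ident C W = Ident C (V \<boxtimes> W)"
    and Tensor_Comp: "\<lbrakk>f \<in> Hom C V V'; f' \<in> Hom C V' V''; g \<in> Hom C W W'; g' \<in> Hom C W' W''\<rbrakk>
      \<Longrightarrow> (f' \<cdot> f) \<star> (g' \<cdot> g) = (f' \<star> g') \<cdot> (f \<star> g)"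
    and Assoc_in_Hom: "\<lbrakk>U \<in> Obj C; V \<in> Obj C; W \<in> Obj C\<rbrakk>
      \<Longrightarrow> \<Phi> U V W \<in> Hom C ((U \<boxtimes> V) \<boxtimes> W) (U \<boxtimes> (V \<boxtimes> W))"
    and Assoc_iso: "\<lbrakk>U \<in> Obj C; V \<in> Obj C; W \<in> Obj C\<rbrakk> \<Longrightarrow> iso_arr C (\<Phi> U V W)"
    and Assoc_natural: "\<lbrakk>f \<in> Hom C U U'; g \<in> Hom C V V'; h \<in> Hom C W W'\<rbrakk>
      \<Longrightarrow> \<Phi> U' V' W' \<cdot> ((f \<star> g) \<star> h) = (f \<star> (g \<star> h)) \<cdot> \<Phi> U V W"
    and pentagon: "\<lbrakk>U \<in> Obj C; V \<in> Obj C; W \<in> Obj C; X \<in> Obj C\<rbrakk>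
      \<Longrightarrow> \<Phi> U V (W \<boxtimes> X) \<cdot> \<Phi> (U \<boxtimes> V) W X
        = (Ident C U \<star> \<Phi> V W X) \<cdot> \<Phi> U (V \<boxtimes> W) X \<cdot> (\<Phi> U V W \<star> Ident C X)"
    and Unit_right: "V \<in> Obj C \<Longrightarrow> V \<boxtimes> Unit C = V"
    and Unit_left: "V \<in> Obj C \<Longrightarrow> Unit C \<boxtimes> V = V"
    and Unit_right_arr: "f \<in> Arr C \<Longrightarrow> f \<star> Ident C (Unit C) = f"
    and Unit_left_arr: "f \<in> Arr C \<Longrightarrow> Ident C (Unit C) \<star> f = f"
    and triangle: "\<lbrakk>V \<in> Obj C; W \<in> Obj C\<rbrakk> \<Longrightarrow> \<Phi> V (Unit C) W = Ident C (V \<boxtimes> W)"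


section \<open>Rigid and pivotal categories\<close>

record ('o, 'm) rigid_cat = "('o, 'm) monoidal_cat" +
  Dual :: "'o \<Rightarrow> 'o"
  ev :: "'o \<Rightarrow> 'm"
  db :: "'o \<Rightarrow> 'm"

locale rigid_monoidal_category = monoidal_category C
  for C :: "('o, 'm, 'z) rigid_cat_scheme" (structure) +
  assumes Dual_in_Obj: "V \<in> Obj C \<Longrightarrow> Dual C V \<in> Obj C"
    and ev_in_Hom: "V \<in> Obj C \<Longrightarrow> ev C V \<in> Hom C (Dual C V \<boxtimes> V) (Unit C)"
    and db_in_Hom: "V \<in> Obj C \<Longrightarrow> db C V \<in> Hom C (Unit C) (V \<boxtimes> Dual C V)"
    and zigzag: "V \<in> Obj C \<Longrightarrow>
      (Ident C V \<star> ev C V) \<cdot> \<Phi> V (Dual C V) V \<cdot> (db C V \<star> Ident C V) = Ident C V"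
    and zigzag_Dual: "V \<in> Obj C \<Longrightarrow>
      (ev C V \<star> Ident C (Dual C V)) \<cdot> inv_arr C (\<Phi> (Dual C V) V (Dual C V))
        \<cdot> (Ident C (Dual C V) \<star> db C V) = Ident C (Dual C V)"
    and Dual_Unit: "Dual C (Unit C) = Unit C"
    and ev_Unit: "ev C (Unit C) = Ident C (Unit C)"
    and db_Unit: "db C (Unit C) = Ident C (Unit C)"

definition dual_arr :: "('o, 'm, 'z) rigid_cat_scheme \<Rightarrow> 'm \<Rightarrow> 'm" where
  "dual_arr C f = (THE g. g \<in> Hom C (Dual C (Cod C f)) (Dual C (Dom C f)) \<and>
     ev C (Dom C f) \<cdot>\<^bsub>C\<^esub> (g \<star>\<^bsub>C\<^esub> Ident C (Dom C f))
       = ev C (Cod C f) \<cdot>\<^bsub>C\<^esub> (Ident C (Dual C (Cod C f)) \<star>\<^bsub>C\<^esub> f))"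

text \<open>
  \<open>W\<^sup>\<or> \<otimes> V\<^sup>\<or>\<close> is a dual of \<open>V \<otimes> W\<close> with the nested evaluation \<open>tensor_ev\<close>; \<open>dual_tensor\<close> is the
  resulting comparison isomorphism \<open>W\<^sup>\<or> \<otimes> V\<^sup>\<or> \<rightarrow> (V \<otimes> W)\<^sup>\<or>\<close>.
\<close>

definition tensor_ev :: "('o, 'm, 'z) rigid_cat_scheme \<Rightarrow> 'o \<Rightarrow> 'o \<Rightarrow> 'm" where
  "tensor_ev C V W =
     ev C W
     \<cdot>\<^bsub>C\<^esub> (Ident C (Dual C W) \<star>\<^bsub>C\<^esub> (ev C V \<star>\<^bsub>C\<^esub> Ident C W))
     \<cdot>\<^bsub>C\<^esub> (Ident C (Dual C W) \<star>\<^bsub>C\<^esub> inv_arr C (\<Phi>\<^bsub>C\<^esub> (Dual C V) V W))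
     \<cdot>\<^bsub>C\<^esub> \<Phi>\<^bsub>C\<^esub> (Dual C W) (Dual C V) (V \<boxtimes>\<^bsub>C\<^esub> W)"

definition dual_tensor :: "('o, 'm, 'z) rigid_cat_scheme \<Rightarrow> 'o \<Rightarrow> 'o \<Rightarrow> 'm" where
  "dual_tensor C V W =
     (THE g. g \<in> Hom C (Dual C W \<boxtimes>\<^bsub>C\<^esub> Dual C V) (Dual C (V \<boxtimes>\<^bsub>C\<^esub> W)) \<and>
        ev C (V \<boxtimes>\<^bsub>C\<^esub> W) \<cdot>\<^bsub>C\<^esub> (g \<star>\<^bsub>C\<^esub> Ident C (V \<boxtimes>\<^bsub>C\<^esub> W)) = tensor_ev C V W)"

text \<open>
  The monoidal structure of the double dual functor,
  \<open>V\<^sup>\<or>\<^sup>\<or> \<otimes> W\<^sup>\<or>\<^sup>\<or> \<rightarrow> (W\<^sup>\<or> \<otimes> V\<^sup>\<or>)\<^sup>\<or> \<rightarrow> (V \<otimes> W)\<^sup>\<or>\<^sup>\<or>\<close>.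
\<close>

definition double_dual_tensor :: "('o, 'm, 'z) rigid_cat_scheme \<Rightarrow> 'o \<Rightarrow> 'o \<Rightarrow> 'm" where
  "double_dual_tensor C V W =
     dual_arr C (inv_arr C (dual_tensor C V W)) \<cdot>\<^bsub>C\<^esub> dual_tensor C (Dual C W) (Dual C V)"

record ('o, 'm) pivotal_cat = "('o, 'm) rigid_cat" +
  piv :: "'o \<Rightarrow> 'm"

locale pivotal_monoidal_category = rigid_monoidal_category C
  for C :: "('o, 'm, 'z) pivotal_cat_scheme" (structure) +
  assumes piv_natural_iso:
      "natural_iso C C (\<lambda>V. V) (\<lambda>f. f)
         (\<lambda>V. Dual C (Dual C V)) (\<lambda>f. dual_arr C (dual_arr C f)) (piv C)"
    and piv_tensor: "\<lbrakk>V \<in> Obj C; W \<in> Obj C\<rbrakk>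
      \<Longrightarrow> piv C (V \<boxtimes> W) = double_dual_tensor C V W \<cdot> (piv C V \<star> piv C W)"
    and piv_Unit: "piv C (Unit C) = Ident C (Unit C)"


section \<open>Linear structure\<close>

text \<open>
  \<open>hadd\<close> and \<open>hsmult\<close> act on all morphism spaces at once; since every arrow has a unique domain and
  codomain, this loses no generality.
\<close>

record ('o, 'm, 'k) linear_pivotal_cat = "('o, 'm) pivotal_cat" +
  hadd :: "'m \<Rightarrow> 'm \<Rightarrow> 'm"
  hzero :: "'o \<Rightarrow> 'o \<Rightarrow> 'm"
  hsmult :: "'k \<Rightarrow> 'm \<Rightarrow> 'm"

text \<open>
  The fields \<open>mult\<close> and \<open>one\<close> only exist because module records extend ring records.
\<close>

definition Hom_space ::
  "('o, 'm, 'k, 'z) linear_pivotal_cat_scheme \<Rightarrow> 'o \<Rightarrow> 'o \<Rightarrow> ('k, 'm) module" where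
  "Hom_space C X Y =
     \<lparr>carrier = Hom C X Y, mult = undefined, one = undefined,
      zero = hzero C X Y, add = hadd C, smult = hsmult C\<rparr>"

locale linear_pivotal_monoidal_category = K: field K + pivotal_monoidal_category C
  for K :: "('k, 'r) ring_scheme"
    and C :: "('o, 'm, 'k, 'z) linear_pivotal_cat_scheme" (structure) +
  assumes Hom_vectorspace: "\<lbrakk>X \<in> Obj C; Y \<in> Obj C\<rbrakk> \<Longrightarrow> vectorspace K (Hom_space C X Y)"
    and Comp_linear_left: "\<lbrakk>f \<in> Hom C X Y; Z \<in> Obj C\<rbrakk>
      \<Longrightarrow> linear_map K (Hom_space C Y Z) (Hom_space C X Z) (\<lambda>g. g \<cdot> f)"
    and Comp_linear_right: "\<lbrakk>X \<in> Obj C; g \<in> Hom C Y Z\<rbrakk>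
      \<Longrightarrow> linear_map K (Hom_space C X Y) (Hom_space C X Z) (\<lambda>f. g \<cdot> f)"
    and Tensor_linear_left: "\<lbrakk>X \<in> Obj C; Y \<in> Obj C; g \<in> Hom C Z W\<rbrakk>
      \<Longrightarrow> linear_map K (Hom_space C X Y) (Hom_space C (X \<boxtimes> Z) (Y \<boxtimes> W)) (\<lambda>f. f \<star> g)"
    and Tensor_linear_right: "\<lbrakk>f \<in> Hom C X Y; Z \<in> Obj C; W \<in> Obj C\<rbrakk>
      \<Longrightarrow> linear_map K (Hom_space C Z W) (Hom_space C (X \<boxtimes> Z) (Y \<boxtimes> W)) (\<lambda>g. f \<star> g)"


section \<open>Monoidal functors\<close>

record ('o1, 'm1, 'o2, 'm2) monoidal_fun =
  FObj :: "'o1 \<Rightarrow> 'o2"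
  FArr :: "'m1 \<Rightarrow> 'm2"
  FTensor :: "'o1 \<Rightarrow> 'o1 \<Rightarrow> 'm2"

locale monoidal_functor = C: monoidal_category C + D: monoidal_category D
  for C :: "('o1, 'm1, 'z1) monoidal_cat_scheme"
    and D :: "('o2, 'm2, 'z2) monoidal_cat_scheme"
    and F :: "('o1, 'm1, 'o2, 'm2) monoidal_fun" +
  assumes is_functor: "is_functor C D (FObj F) (FArr F)"
    and FTensor_in_Hom: "\<lbrakk>V \<in> Obj C; W \<in> Obj C\<rbrakk>
      \<Longrightarrow> FTensor F V W \<in> Hom D (FObj F V \<boxtimes>\<^bsub>D\<^esub> FObj F W) (FObj F (V \<boxtimes>\<^bsub>C\<^esub> W))"
    and FTensor_iso: "\<lbrakk>V \<in> Obj C; W \<in> Obj C\<rbrakk> \<Longrightarrow> iso_arr D (FTensor F V W)"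
    and FTensor_natural: "\<lbrakk>f \<in> Hom C V V'; g \<in> Hom C W W'\<rbrakk>
      \<Longrightarrow> FTensor F V' W' \<cdot>\<^bsub>D\<^esub> (FArr F f \<star>\<^bsub>D\<^esub> FArr F g)
        = FArr F (f \<star>\<^bsub>C\<^esub> g) \<cdot>\<^bsub>D\<^esub> FTensor F V W"
    and FTensor_coherent: "\<lbrakk>U \<in> Obj C; V \<in> Obj C; W \<in> Obj C\<rbrakk>
      \<Longrightarrow> FTensor F U (V \<boxtimes>\<^bsub>C\<^esub> W) \<cdot>\<^bsub>D\<^esub> (Ident D (FObj F U) \<star>\<^bsub>D\<^esub> FTensor F V W)
          \<cdot>\<^bsub>D\<^esub> \<Phi>\<^bsub>D\<^esub> (FObj F U) (FObj F V) (FObj F W)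
        = FArr F (\<Phi>\<^bsub>C\<^esub> U V W) \<cdot>\<^bsub>D\<^esub> FTensor F (U \<boxtimes>\<^bsub>C\<^esub> V) W
          \<cdot>\<^bsub>D\<^esub> (FTensor F U V \<star>\<^bsub>D\<^esub> Ident D (FObj F W))"
    and FObj_Unit: "FObj F (Unit C) = Unit D"
    and FTensor_Unit_right: "V \<in> Obj C \<Longrightarrow> FTensor F V (Unit C) = Ident D (FObj F V)"
    and FTensor_Unit_left: "V \<in> Obj C \<Longrightarrow> FTensor F (Unit C) V = Ident D (FObj F V)"

definition duality_transf ::
  "('o1, 'm1, 'z1) rigid_cat_scheme \<Rightarrow> ('o2, 'm2, 'z2) rigid_cat_scheme
     \<Rightarrow> ('o1, 'm1, 'o2, 'm2) monoidal_fun \<Rightarrow> 'o1 \<Rightarrow> 'm2" where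
  "duality_transf C D F X =
     (THE g. g \<in> Hom D (FObj F (Dual C X)) (Dual D (FObj F X)) \<and>
        ev D (FObj F X) \<cdot>\<^bsub>D\<^esub> (g \<star>\<^bsub>D\<^esub> Ident D (FObj F X))
          = FArr F (ev C X) \<cdot>\<^bsub>D\<^esub> FTensor F (Dual C X) X)"

definition preserves_pivotal ::
  "('o1, 'm1, 'z1) pivotal_cat_scheme \<Rightarrow> ('o2, 'm2, 'z2) pivotal_cat_scheme
     \<Rightarrow> ('o1, 'm1, 'o2, 'm2) monoidal_fun \<Rightarrow> bool" where
  "preserves_pivotal C D F \<longleftrightarrow> (\<forall>X \<in> Obj C.
     duality_transf C D F (Dual C X) \<cdot>\<^bsub>D\<^esub> FArr F (piv C X)
       = dual_arr D (duality_transf C D F X) \<cdot>\<^bsub>D\<^esub> piv D (FObj F X))"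

definition linear_functor ::
  "('k, 'r) ring_scheme \<Rightarrow> ('o1, 'm1, 'k, 'z1) linear_pivotal_cat_scheme
     \<Rightarrow> ('o2, 'm2, 'k, 'z2) linear_pivotal_cat_scheme
     \<Rightarrow> ('o1, 'm1, 'o2, 'm2) monoidal_fun \<Rightarrow> bool" where
  "linear_functor K C D F \<longleftrightarrow> (\<forall>X \<in> Obj C. \<forall>Y \<in> Obj C.
     linear_map K (Hom_space C X Y) (Hom_space D (FObj F X) (FObj F Y)) (FArr F))"


section \<open>Trace of a linear endomorphism\<close>

definition basis_coords ::
  "('k, 'r) ring_scheme \<Rightarrow> ('k, 'v, 's) module_scheme \<Rightarrow> 'v set \<Rightarrow> 'v \<Rightarrow> 'v \<Rightarrow> 'k" where
  "basis_coords K V B v = (THE a. a \<in> B \<rightarrow>\<^sub>E carrier K \<and> module.lincomb V a B = v)"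

text \<open>
  The sum of the diagonal entries of the matrix of \<open>T\<close>; the value does not depend on the basis.
\<close>

definition linear_trace ::
  "('k, 'r) ring_scheme \<Rightarrow> ('k, 'v, 's) module_scheme \<Rightarrow> ('v \<Rightarrow> 'v) \<Rightarrow> 'k" where
  "linear_trace K V T =
     (let B = (SOME B. finite B \<and> vectorspace.basis K V B)
      in \<Oplus>\<^bsub>K\<^esub> b \<in> B. basis_coords K V B (T b) b)"


section \<open>Frobenius-Schur indicators\<close>

primrec tensor_pow :: "('o, 'm, 'z) monoidal_cat_scheme \<Rightarrow> 'o \<Rightarrow> nat \<Rightarrow> 'o" where
  "tensor_pow C V 0 = Unit C"
| "tensor_pow C V (Suc n) = V \<boxtimes>\<^bsub>C\<^esub> tensor_pow C V n"

text \<open>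
  \<open>assoc_pow C V n\<close> is \<open>\<Phi>\<^sup>(\<^sup>n\<^sup>) : V\<^sup>\<otimes>\<^sup>(\<^sup>n\<^sup>-\<^sup>1\<^sup>) \<otimes> V \<rightarrow> V\<^sup>\<otimes>\<^sup>n\<close>, which only exists for \<open>n \<ge> 1\<close>.
\<close>

fun assoc_pow :: "('o, 'm, 'z) monoidal_cat_scheme \<Rightarrow> 'o \<Rightarrow> nat \<Rightarrow> 'm" where
  "assoc_pow C V 0 = undefined"
| "assoc_pow C V (Suc 0) = Ident C V"
| "assoc_pow C V (Suc (Suc n)) =
     (Ident C V \<star>\<^bsub>C\<^esub> assoc_pow C V (Suc n)) \<cdot>\<^bsub>C\<^esub> \<Phi>\<^bsub>C\<^esub> V (tensor_pow C V n) V"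

definition A_map :: "('o, 'm, 'z) rigid_cat_scheme \<Rightarrow> 'o \<Rightarrow> 'o \<Rightarrow> 'm \<Rightarrow> 'm" where
  "A_map C V W f = (ev C V \<star>\<^bsub>C\<^esub> Ident C W) \<cdot>\<^bsub>C\<^esub> inv_arr C (\<Phi>\<^bsub>C\<^esub> (Dual C V) V W)
     \<cdot>\<^bsub>C\<^esub> (Ident C (Dual C V) \<star>\<^bsub>C\<^esub> f)"

text \<open>The inverse of \<open>A_map C V W\<close>; its formula does not involve \<open>W\<close>.\<close>

definition A_inv :: "('o, 'm, 'z) rigid_cat_scheme \<Rightarrow> 'o \<Rightarrow> 'm \<Rightarrow> 'm" where
  "A_inv C V g = (Ident C V \<star>\<^bsub>C\<^esub> g) \<cdot>\<^bsub>C\<^esub> db C V"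

definition T_map :: "('o, 'm, 'z) pivotal_cat_scheme \<Rightarrow> 'o \<Rightarrow> 'm \<Rightarrow> 'm" where
  "T_map C V f = inv_arr C (piv C V) \<cdot>\<^bsub>C\<^esub> dual_arr C f"

definition E_map :: "('o, 'm, 'z) pivotal_cat_scheme \<Rightarrow> 'o \<Rightarrow> 'o \<Rightarrow> 'm \<Rightarrow> 'm" where
  "E_map C V W f = A_inv C W (T_map C V (A_map C V W f))"

definition E_pow :: "('o, 'm, 'z) pivotal_cat_scheme \<Rightarrow> 'o \<Rightarrow> nat \<Rightarrow> 'm \<Rightarrow> 'm" where
  "E_pow C V n f = assoc_pow C V n \<cdot>\<^bsub>C\<^esub> E_map C V (tensor_pow C V (n - 1)) f"

definition fs_indicator ::
  "('k, 'r) ring_scheme \<Rightarrow> ('o, 'm, 'k, 'z) linear_pivotal_cat_scheme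
     \<Rightarrow> nat \<Rightarrow> nat \<Rightarrow> 'o \<Rightarrow> 'k" where
  "fs_indicator K C n r V =
     linear_trace K (Hom_space C (Unit C) (tensor_pow C V n)) (E_pow C V n ^^ r)"

end

theory Submission
  imports Defs
begin

text \<open>
  The endomorphism \<open>E\<close> whose powers define the indicators is built from the pivotal monoidal structure
  alone, and \<open>F\<close> carries that structure from \<open>C\<close> to \<open>D\<close> up to the isomorphisms \<open>\<xi>\<close> and the duality
  transformation \<open>\<theta>\<close>. Write \<open>\<xi>\<^sup>n\<close> for the iterated comparison \<open>F(V)\<^sup>\<otimes>\<^sup>n \<rightarrow> F(V\<^sup>\<otimes>\<^sup>n)\<close>. The map
  \<open>S(f) = (\<xi>\<^sup>n)\<^sup>-\<^sup>1 F(f)\<close> is a linear bijection from \<open>C(I, V\<^sup>\<otimes>\<^sup>n)\<close> to \<open>D(I, F(V)\<^sup>\<otimes>\<^sup>n)\<close>, because \<open>F\<close> is linear and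
  fully faithful (\<open>equivalence_bij_betw_Hom\<close>), and it intertwines the two rotations
  (\<open>transport_E_pow\<close>). Conjugate endomorphisms have the same trace (\<open>linear_trace_conjugate\<close>).

  The intertwining rests on eliminating the dual arrow from the definition of \<open>E\<close>. For \<open>g : V \<rightarrow> W\<close>
  one has \<open>(W \<otimes> g\<^sup>\<or>) db\<^sub>W = (g \<otimes> V\<^sup>\<or>) db\<^sub>V\<close> (\<open>dual_arr_db\<close>), hence
  \<open>E(f) = (A(f) \<otimes> j\<^sub>V\<^sup>-\<^sup>1) db\<close> with \<open>db\<close> taken at \<open>V\<^sup>\<or>\<close> (\<open>E_map_eq\<close>). In this form \<open>E\<close> is visibly linear in
  \<open>f\<close> and natural in \<open>W\<close>, and only the images of \<open>db\<close>, \<open>A(f)\<close> and \<open>j\<close> have to be understood.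

  The object \<open>F(X\<^sup>\<or>)\<close> with \<open>F(ev) \<xi>\<close> and \<open>\<xi>\<^sup>-\<^sup>1 F(db)\<close> is again a dual of \<open>F(X)\<close>
  (\<open>image_dual_pair\<close>), and \<open>\<theta>\<^sub>X\<close> is the comparison of this dual with the chosen one. It therefore is
  invertible, sends \<open>\<xi>\<^sup>-\<^sup>1 F(db)\<close> to \<open>db\<close>, and satisfies \<open>F(A(f)) = A(\<xi>\<^sup>-\<^sup>1 F(f)) \<theta>\<^sub>V\<close>.
  After substitution the identity \<open>\<xi>\<^sup>-\<^sup>1 F(E(f)) = E(\<xi>\<^sup>-\<^sup>1 F(f))\<close> (\<open>lift_E_map\<close>) comes down to
  \<open>\<theta> F(j\<^sub>V) = (\<theta>\<^sub>V)\<^sup>\<or> j\<close> with \<open>\<theta>\<close> at \<open>V\<^sup>\<or>\<close> and \<open>j\<close> at \<open>F(V)\<close>, which is preservation of the pivotal structure.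
  The associativity isomorphism \<open>\<Phi>\<^sup>(\<^sup>n\<^sup>)\<close> is carried along by the coherence of \<open>\<xi>\<close>
  (\<open>assoc_pow_comparison\<close>).
\<close>

section \<open>Categories and isomorphisms\<close>

text \<open>
  Arrows are typed by rewriting with \<open>Dom\<close> and \<open>Cod\<close> rather than by membership in \<open>Hom\<close> sets:
  the strictness equations \<open>V \<otimes> I = V = I \<otimes> V\<close> then act on the types automatically.
\<close>

context category begin

lemma Hom_iff: "f \<in> Hom C X Y \<longleftrightarrow> f \<in> Arr C \<and> Dom C f = X \<and> Cod C f = Y"
  by (simp add: Hom_def)

declare Dom_in_Obj [simp] Cod_in_Obj [simp]

lemma Ident_simps [simp]:
  "X \<in> Obj C \<Longrightarrow> Ident C X \<in> Arr C"
  "X \<in> Obj C \<Longrightarrow> Dom C (Ident C X) = X"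
  "X \<in> Obj C \<Longrightarrow> Cod C (Ident C X) = X"
  using Ident_in_Hom by (auto simp: Hom_iff)

lemma Comp_simps [simp]:
  assumes "f \<in> Arr C" "g \<in> Arr C" "Dom C g = Cod C f"
  shows "g \<cdot> f \<in> Arr C" "Dom C (g \<cdot> f) = Dom C f" "Cod C (g \<cdot> f) = Cod C g"
  using Comp_in_Hom[of f "Dom C f" "Cod C f" g "Cod C g"] assms by (auto simp: Hom_iff)

lemma Comp_Ident_simps [simp]:
  "\<lbrakk>f \<in> Arr C; Cod C f = Y\<rbrakk> \<Longrightarrow> Ident C Y \<cdot> f = f"
  "\<lbrakk>f \<in> Arr C; Dom C f = X\<rbrakk> \<Longrightarrow> f \<cdot> Ident C X = f"
  using Comp_Ident_left Comp_Ident_right by (auto simp: Hom_iff)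

lemma Comp_assoc_arr [simp]:
  "\<lbrakk>f \<in> Arr C; g \<in> Arr C; h \<in> Arr C; Dom C g = Cod C f; Dom C h = Cod C g\<rbrakk>
    \<Longrightarrow> (h \<cdot> g) \<cdot> f = h \<cdot> (g \<cdot> f)"
  using Comp_assoc by (auto simp: Hom_iff)

text \<open>
  Composites are normalised by nesting to the right, so an equation for \<open>g \<cdot> f\<close> does not match
  inside \<open>g \<cdot> (f \<cdot> h)\<close>. This variant applies it there.
\<close>

lemma reassoc:
  assumes "g \<cdot> f = k" "h \<in> Arr C" "f \<in> Arr C" "g \<in> Arr C" "Dom C f = Cod C h" "Dom C g = Cod C f"
  shows "g \<cdot> (f \<cdot> h) = k \<cdot> h"
  using assms Comp_assoc_arr[of h f g] by simp

lemma inverse_arrows_unique: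
  assumes "inverse_arrows C f g" "inverse_arrows C f g'"
  shows "g = g'"
proof -
  have "g = g \<cdot> (f \<cdot> g')"
    using assms by (simp add: inverse_arrows_def Hom_iff)
  also have "\<dots> = (g \<cdot> f) \<cdot> g'"
    using assms by (intro Comp_assoc_arr[symmetric]) (auto simp: inverse_arrows_def Hom_iff)
  also have "\<dots> = g'"
    using assms by (simp add: inverse_arrows_def Hom_iff)
  finally show ?thesis .
qed

lemma inverse_arrows_inv_arr: "iso_arr C f \<Longrightarrow> inverse_arrows C f (inv_arr C f)"
  unfolding iso_arr_def inv_arr_def
  by (rule theI') (use inverse_arrows_unique in blast)

lemma inv_arr_simps [simp]:
  assumes "iso_arr C f"
  shows "inv_arr C f \<in> Arr C" "Dom C (inv_arr C f) = Cod C f" "Cod C (inv_arr C f) = Dom C f"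
    "inv_arr C f \<cdot> f = Ident C (Dom C f)" "f \<cdot> inv_arr C f = Ident C (Cod C f)"
    "f \<in> Arr C"
  using inverse_arrows_inv_arr[OF assms] by (auto simp: inverse_arrows_def Hom_iff)

lemma inv_arr_cancel [simp]:
  assumes "iso_arr C f" "h \<in> Arr C"
  shows "Cod C h = Dom C f \<Longrightarrow> inv_arr C f \<cdot> (f \<cdot> h) = h"
    and "Cod C h = Cod C f \<Longrightarrow> f \<cdot> (inv_arr C f \<cdot> h) = h"
  using assms by (simp_all flip: Comp_assoc_arr)

lemma iso_arrI:
  assumes "f \<in> Hom C X Y" "g \<in> Hom C Y X" "g \<cdot> f = Ident C X" "f \<cdot> g = Ident C Y"
  shows "iso_arr C f"
  using assms unfolding iso_arr_def inverse_arrows_def by (auto simp: Hom_iff)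

lemma iso_Ident: "X \<in> Obj C \<Longrightarrow> iso_arr C (Ident C X)"
  by (rule iso_arrI[where g = "Ident C X"]) (simp_all add: Hom_iff)

lemma iso_cancel_left:
  assumes "iso_arr C h" "f \<in> Arr C" "g \<in> Arr C" "Cod C f = Dom C h" "Cod C g = Dom C h"
    "h \<cdot> f = h \<cdot> g"
  shows "f = g"
proof -
  have "f = inv_arr C h \<cdot> (h \<cdot> f)"
    using assms(1-5) by simp
  also have "\<dots> = inv_arr C h \<cdot> (h \<cdot> g)"
    by (simp only: assms(6))
  also have "\<dots> = g"
    using assms(1-5) by simp
  finally show ?thesis .
qed

lemma iso_comp:
  assumes "iso_arr C f" "iso_arr C g" "Dom C g = Cod C f"
  shows "iso_arr C (g \<cdot> f)"
  by (rule iso_arrI[where g = "inv_arr C f \<cdot> inv_arr C g" and X = "Dom C f" and Y = "Cod C g"])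
    (use assms in \<open>simp_all add: Hom_iff\<close>)

end

section \<open>Monoidal categories with strict unit\<close>

context monoidal_category begin

lemma Tensor_simps [simp]:
  assumes "f \<in> Arr C" "g \<in> Arr C"
  shows "f \<star> g \<in> Arr C" "Dom C (f \<star> g) = Dom C f \<boxtimes> Dom C g" "Cod C (f \<star> g) = Cod C f \<boxtimes> Cod C g"
  using Tensor_in_Hom[of f "Dom C f" "Cod C f" g "Dom C g" "Cod C g"] assms by (auto simp: Hom_iff)

declare Unit_in_Obj [simp] Tensor_in_Obj [simp] Tensor_Ident [simp] Unit_right [simp] Unit_left [simp]
  Unit_right_arr [simp] Unit_left_arr [simp] Assoc_iso [simp] triangle [simp]

lemma Assoc_simps [simp]:
  assumes "U \<in> Obj C" "V \<in> Obj C" "W \<in> Obj C"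
  shows "\<Phi> U V W \<in> Arr C" "Dom C (\<Phi> U V W) = (U \<boxtimes> V) \<boxtimes> W" "Cod C (\<Phi> U V W) = U \<boxtimes> (V \<boxtimes> W)"
  using Assoc_in_Hom[OF assms] by (auto simp: Hom_iff)

lemma interchange:
  assumes "f \<in> Arr C" "f' \<in> Arr C" "g \<in> Arr C" "g' \<in> Arr C" "Dom C f' = Cod C f" "Dom C g' = Cod C g"
  shows "(f' \<star> g') \<cdot> (f \<star> g) = (f' \<cdot> f) \<star> (g' \<cdot> g)"
  using assms by (intro Tensor_Comp[symmetric]) (auto simp: Hom_iff)

lemma Assoc_natural_arr:
  assumes "f \<in> Arr C" "g \<in> Arr C" "h \<in> Arr C"
  shows "\<Phi> (Cod C f) (Cod C g) (Cod C h) \<cdot> ((f \<star> g) \<star> h)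
    = (f \<star> (g \<star> h)) \<cdot> \<Phi> (Dom C f) (Dom C g) (Dom C h)"
  using assms by (intro Assoc_natural) (auto simp: Hom_iff)

lemma Assoc_inv_natural_arr:
  assumes "f \<in> Arr C" "g \<in> Arr C" "h \<in> Arr C"
  shows "inv_arr C (\<Phi> (Cod C f) (Cod C g) (Cod C h)) \<cdot> (f \<star> (g \<star> h))
    = ((f \<star> g) \<star> h) \<cdot> inv_arr C (\<Phi> (Dom C f) (Dom C g) (Dom C h))"
    (is "?i' \<cdot> ?t = ?s \<cdot> ?i")
proof -
  have "?i' \<cdot> ?t = ?i' \<cdot> (?t \<cdot> \<Phi> (Dom C f) (Dom C g) (Dom C h)) \<cdot> ?i"
    using assms by simp
  also have "\<dots> = ?i' \<cdot> (\<Phi> (Cod C f) (Cod C g) (Cod C h) \<cdot> ?s) \<cdot> ?i"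
    using assms by (simp only: Assoc_natural_arr)
  also have "\<dots> = ?s \<cdot> ?i"
    using assms by simp
  finally show ?thesis .
qed

text \<open>
  The triangle axiom speaks only about a unit in the middle. In the pentagon with two units in
  front, it leaves \<open>\<Phi> \<cdot> \<Phi> = \<Phi>\<close> for \<open>\<Phi> = \<Phi> I V W\<close>, and an idempotent isomorphism is an identity.
\<close>

lemma Assoc_Unit_left [simp]:
  assumes "V \<in> Obj C" "W \<in> Obj C" shows "\<Phi> (Unit C) V W = Ident C (V \<boxtimes> W)"
proof -
  have "\<Phi> (Unit C) V W \<cdot> \<Phi> (Unit C) V W
      = (Ident C (Unit C) \<star> \<Phi> (Unit C) V W) \<cdot> \<Phi> (Unit C) (Unit C \<boxtimes> V) W
        \<cdot> (\<Phi> (Unit C) (Unit C) V \<star> Ident C W)"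
    using assms by simp
  also have "\<dots> = \<Phi> (Unit C) (Unit C) (V \<boxtimes> W) \<cdot> \<Phi> (Unit C \<boxtimes> Unit C) V W"
    using assms by (intro pentagon[symmetric]) simp_all
  also have "\<dots> = \<Phi> (Unit C) V W \<cdot> Ident C (V \<boxtimes> W)"
    using assms by simp
  finally have "\<Phi> (Unit C) V W \<cdot> \<Phi> (Unit C) V W = \<Phi> (Unit C) V W \<cdot> Ident C (V \<boxtimes> W)" .
  then show ?thesis
    by (rule iso_cancel_left[rotated -1]) (use assms in simp_all)
qed

lemma Assoc_Unit_right [simp]:
  assumes "V \<in> Obj C" "W \<in> Obj C" shows "\<Phi> V W (Unit C) = Ident C (V \<boxtimes> W)"
proof -
  have "\<Phi> V W (Unit C) \<cdot> \<Phi> V W (Unit C)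
      = (Ident C V \<star> \<Phi> W (Unit C) (Unit C)) \<cdot> \<Phi> V (W \<boxtimes> Unit C) (Unit C)
        \<cdot> (\<Phi> V W (Unit C) \<star> Ident C (Unit C))"
    using assms by simp
  also have "\<dots> = \<Phi> V W (Unit C \<boxtimes> Unit C) \<cdot> \<Phi> (V \<boxtimes> W) (Unit C) (Unit C)"
    using assms by (intro pentagon[symmetric]) simp_all
  also have "\<dots> = \<Phi> V W (Unit C) \<cdot> Ident C (V \<boxtimes> W)"
    using assms by simp
  finally have "\<Phi> V W (Unit C) \<cdot> \<Phi> V W (Unit C) = \<Phi> V W (Unit C) \<cdot> Ident C (V \<boxtimes> W)" .
  then show ?thesis
    by (rule iso_cancel_left[rotated -1]) (use assms in simp_all)
qed

lemma inv_Ident [simp]: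
  assumes "X \<in> Obj C" shows "inv_arr C (Ident C X) = Ident C X"
proof -
  have inv: "inverse_arrows C (Ident C X) (Ident C X)"
    using assms by (simp add: inverse_arrows_def Hom_iff)
  then have "inverse_arrows C (Ident C X) (inv_arr C (Ident C X))"
    by (intro inverse_arrows_inv_arr) (auto simp: iso_arr_def)
  then show ?thesis
    using inv by (rule inverse_arrows_unique)
qed

lemma iso_tensor:
  assumes "iso_arr C f" "iso_arr C g"
  shows "iso_arr C (f \<star> g)"
  by (rule iso_arrI[where g = "inv_arr C f \<star> inv_arr C g"
        and X = "Dom C f \<boxtimes> Dom C g" and Y = "Cod C f \<boxtimes> Cod C g"])
    (use assms in \<open>simp_all add: Hom_iff interchange\<close>)

lemma whisker_left:
  assumes "f \<in> Arr C" "g \<in> Arr C" "Dom C g = Cod C f" "V \<in> Obj C"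
  shows "Ident C V \<star> (g \<cdot> f) = (Ident C V \<star> g) \<cdot> (Ident C V \<star> f)"
  using assms by (simp add: interchange)

lemma whisker_right:
  assumes "f \<in> Arr C" "g \<in> Arr C" "Dom C g = Cod C f" "V \<in> Obj C"
  shows "(g \<cdot> f) \<star> Ident C V = (g \<star> Ident C V) \<cdot> (f \<star> Ident C V)"
  using assms by (simp add: interchange)

lemma slide:
  assumes "f \<in> Arr C" "g \<in> Arr C" "Cod C f = X'" "Dom C f = X" "Cod C g = Y'" "Dom C g = Y"
  shows "(f \<star> Ident C Y') \<cdot> (Ident C X \<star> g) = (Ident C X' \<star> g) \<cdot> (f \<star> Ident C Y)"
  using assms by (auto simp: interchange)

text \<open>
  When one of the two arrows ends or starts at the unit object, one leg of the interchange law
  disappears and an arrow can be moved past an evaluation or a coevaluation.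
\<close>

lemma slide_counit:
  assumes "e \<in> Arr C" "g \<in> Arr C" "Dom C e = X" "Cod C e = Unit C" "Cod C g = Y'" "Dom C g = Y"
  shows "(e \<star> Ident C Y') \<cdot> (Ident C X \<star> g) = g \<cdot> (e \<star> Ident C Y)"
  using slide[of e g "Unit C" X Y' Y] assms by simp

lemma slide_counit':
  assumes "e \<in> Arr C" "g \<in> Arr C" "Dom C e = X" "Cod C e = Unit C" "Cod C g = Unit C" "Dom C g = Y"
  shows "e \<cdot> (g \<star> Ident C X) = g \<cdot> (Ident C Y \<star> e)"
  using slide[of g e "Unit C" Y "Unit C" X] assms by simp

lemma slide_unit:
  assumes "d \<in> Arr C" "g \<in> Arr C" "Cod C d = X" "Dom C d = Unit C" "Cod C g = Y'" "Dom C g = Y"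
  shows "(Ident C X \<star> g) \<cdot> (d \<star> Ident C Y) = (d \<star> Ident C Y') \<cdot> g"
  using slide[of d g X "Unit C" Y' Y] assms by simp

lemma slide_unit':
  assumes "d \<in> Arr C" "g \<in> Arr C" "Cod C d = X" "Dom C d = Unit C" "Cod C g = Y'" "Dom C g = Y"
  shows "(g \<star> Ident C X) \<cdot> (Ident C Y \<star> d) = (Ident C Y' \<star> d) \<cdot> g"
  using slide[of g d Y' Y X "Unit C"] assms by simp

text \<open>
  These two rearrangements of the pentagon bring the evaluation and the coevaluation of a dual
  next to each other.
\<close>

lemma pentagon_inv_left:
  assumes [simp]: "U \<in> Obj C" "V \<in> Obj C" "W \<in> Obj C" "Y \<in> Obj C"
  shows "\<Phi> (U \<boxtimes> V) W Y \<cdot> (inv_arr C (\<Phi> U V W) \<star> Ident C Y)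
    = inv_arr C (\<Phi> U V (W \<boxtimes> Y)) \<cdot> (Ident C U \<star> \<Phi> V W Y) \<cdot> \<Phi> U (V \<boxtimes> W) Y"
proof -
  have "\<Phi> (U \<boxtimes> V) W Y \<cdot> (inv_arr C (\<Phi> U V W) \<star> Ident C Y)
    = inv_arr C (\<Phi> U V (W \<boxtimes> Y)) \<cdot> (\<Phi> U V (W \<boxtimes> Y) \<cdot> \<Phi> (U \<boxtimes> V) W Y)
      \<cdot> (inv_arr C (\<Phi> U V W) \<star> Ident C Y)"
    by simp
  also have "\<dots> = inv_arr C (\<Phi> U V (W \<boxtimes> Y)) \<cdot> (Ident C U \<star> \<Phi> V W Y) \<cdot> \<Phi> U (V \<boxtimes> W) Y
      \<cdot> ((\<Phi> U V W \<star> Ident C Y) \<cdot> (inv_arr C (\<Phi> U V W) \<star> Ident C Y))"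
    by (subst pentagon) simp_all
  finally show ?thesis
    by (simp add: interchange)
qed

lemma pentagon_inv_right:
  assumes [simp]: "U \<in> Obj C" "V \<in> Obj C" "W \<in> Obj C" "Y \<in> Obj C"
  shows "(Ident C U \<star> inv_arr C (\<Phi> V W Y)) \<cdot> \<Phi> U V (W \<boxtimes> Y)
    = \<Phi> U (V \<boxtimes> W) Y \<cdot> (\<Phi> U V W \<star> Ident C Y) \<cdot> inv_arr C (\<Phi> (U \<boxtimes> V) W Y)"
proof -
  have "(Ident C U \<star> inv_arr C (\<Phi> V W Y)) \<cdot> \<Phi> U V (W \<boxtimes> Y)
    = (Ident C U \<star> inv_arr C (\<Phi> V W Y)) \<cdot> (\<Phi> U V (W \<boxtimes> Y) \<cdot> \<Phi> (U \<boxtimes> V) W Y)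
      \<cdot> inv_arr C (\<Phi> (U \<boxtimes> V) W Y)"
    by simp
  also have "\<dots> = ((Ident C U \<star> inv_arr C (\<Phi> V W Y)) \<cdot> (Ident C U \<star> \<Phi> V W Y)) \<cdot> \<Phi> U (V \<boxtimes> W) Y
      \<cdot> (\<Phi> U V W \<star> Ident C Y) \<cdot> inv_arr C (\<Phi> (U \<boxtimes> V) W Y)"
    by (subst pentagon) simp_all
  finally show ?thesis
    by (simp add: interchange)
qed

end

section \<open>Dual pairs\<close>

text \<open>
  A dual of \<open>V\<close> that need not be the chosen one. Images of duals under a monoidal functor are of
  this kind.
\<close>

locale dual_pair = monoidal_category C
  for C :: "('o, 'm, 'z) monoidal_cat_scheme" (structure) +
  fixes V X :: 'o and e d :: 'm
  assumes V_obj [simp]: "V \<in> Obj C" and X_obj [simp]: "X \<in> Obj C"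
    and e_Hom: "e \<in> Hom C (X \<boxtimes> V) (Unit C)"
    and d_Hom: "d \<in> Hom C (Unit C) (V \<boxtimes> X)"
    and zz: "(Ident C V \<star> e) \<cdot> \<Phi> V X V \<cdot> (d \<star> Ident C V) = Ident C V"
    and zz_dual: "(e \<star> Ident C X) \<cdot> inv_arr C (\<Phi> X V X) \<cdot> (Ident C X \<star> d) = Ident C X"
begin

text \<open>
  The inverse of \<open>g \<mapsto> e \<cdot> (g \<star> V)\<close>, where \<open>g : U \<rightarrow> X\<close>.
\<close>

definition mate :: "'o \<Rightarrow> 'm \<Rightarrow> 'm" where
  "mate U h = (h \<star> Ident C X) \<cdot> inv_arr C (\<Phi> U V X) \<cdot> (Ident C U \<star> d)"

text \<open>
  The inverse of \<open>g \<mapsto> (V \<star> g) \<cdot> d\<close>, where \<open>g : X \<rightarrow> W\<close>; for the chosen dual it is \<open>A_map C V W\<close>.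
\<close>

definition bend :: "'o \<Rightarrow> 'm \<Rightarrow> 'm" where
  "bend W f = (e \<star> Ident C W) \<cdot> inv_arr C (\<Phi> X V W) \<cdot> (Ident C X \<star> f)"

lemma ed_simps [simp]:
  "e \<in> Arr C" "Dom C e = X \<boxtimes> V" "Cod C e = Unit C"
  "d \<in> Arr C" "Dom C d = Unit C" "Cod C d = V \<boxtimes> X"
  using e_Hom d_Hom by (auto simp: Hom_iff)

lemma mate_simps [simp]:
  assumes "U \<in> Obj C" "h \<in> Arr C" "Dom C h = U \<boxtimes> V" "Cod C h = Unit C"
  shows "mate U h \<in> Arr C" "Dom C (mate U h) = U" "Cod C (mate U h) = X"
  using assms by (simp_all add: mate_def)

lemma bend_simps [simp]:
  assumes "W \<in> Obj C" "f \<in> Arr C" "Dom C f = Unit C" "Cod C f = V \<boxtimes> W"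
  shows "bend W f \<in> Arr C" "Dom C (bend W f) = X" "Cod C (bend W f) = W"
  using assms by (simp_all add: bend_def)

text \<open>
  Moving \<open>g\<close> out to the left past the associator and \<open>e\<close> leaves one of the zigzag identities.
\<close>

lemma bend_unbend:
  assumes [simp]: "g \<in> Arr C" "Dom C g = X" "Cod C g = W"
  shows "bend W ((Ident C V \<star> g) \<cdot> d) = g"
proof -
  have [simp]: "W \<in> Obj C" using Cod_in_Obj[of g] by simp
  have 1: "Ident C X \<star> ((Ident C V \<star> g) \<cdot> d)
      = (Ident C X \<star> (Ident C V \<star> g)) \<cdot> (Ident C X \<star> d)"
    by (simp add: whisker_left)
  have 2: "inv_arr C (\<Phi> X V W) \<cdot> (Ident C X \<star> (Ident C V \<star> g))
      = (Ident C (X \<boxtimes> V) \<star> g) \<cdot> inv_arr C (\<Phi> X V X)"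
    using Assoc_inv_natural_arr[of "Ident C X" "Ident C V" g] by simp
  have 3: "(e \<star> Ident C W) \<cdot> (Ident C (X \<boxtimes> V) \<star> g) = g \<cdot> (e \<star> Ident C X)"
    by (simp add: slide_counit)
  show ?thesis
    unfolding bend_def by (simp add: 1 reassoc[OF 2] reassoc[OF 3] zz_dual)
qed

lemma mate_unmate:
  assumes [simp]: "g \<in> Arr C" "Dom C g = U" "Cod C g = X"
  shows "mate U (e \<cdot> (g \<star> Ident C V)) = g"
proof -
  have [simp]: "U \<in> Obj C" using Dom_in_Obj[of g] by simp
  have 1: "(e \<cdot> (g \<star> Ident C V)) \<star> Ident C X = (e \<star> Ident C X) \<cdot> ((g \<star> Ident C V) \<star> Ident C X)"
    by (simp add: whisker_right)
  have 2: "((g \<star> Ident C V) \<star> Ident C X) \<cdot> inv_arr C (\<Phi> U V X)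
      = inv_arr C (\<Phi> X V X) \<cdot> (g \<star> Ident C (V \<boxtimes> X))"
    using Assoc_inv_natural_arr[of g "Ident C V" "Ident C X"] by simp
  have 3: "(g \<star> Ident C (V \<boxtimes> X)) \<cdot> (Ident C U \<star> d) = (Ident C X \<star> d) \<cdot> g"
    by (simp add: slide_unit')
  have 4: "(e \<star> Ident C X) \<cdot> inv_arr C (\<Phi> X V X) \<cdot> (Ident C X \<star> d) \<cdot> g = g"
    using arg_cong[OF zz_dual, of "\<lambda>f. f \<cdot> g"] by simp
  show ?thesis
    unfolding mate_def
    by (simp add: 1 reassoc[OF 2] 3 4)
qed

text \<open>
  The formula for the mate places \<open>d\<close> inside a tensor factor, so two associators separate it from
  \<open>e\<close>. The pentagon rearranges them so that the other zigzag composite appears, tensored with \<open>U\<close>.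
\<close>

lemma ev_mate:
  assumes [simp]: "h \<in> Arr C" "Dom C h = U \<boxtimes> V" "Cod C h = Unit C" "U \<in> Obj C"
  shows "e \<cdot> (mate U h \<star> Ident C V) = h"
proof -
  have 1: "mate U h \<star> Ident C V = ((h \<star> Ident C X) \<star> Ident C V)
      \<cdot> (inv_arr C (\<Phi> U V X) \<star> Ident C V) \<cdot> ((Ident C U \<star> d) \<star> Ident C V)"
    by (simp add: whisker_right mate_def)
  have 2: "(h \<star> Ident C X) \<star> Ident C V = (h \<star> Ident C (X \<boxtimes> V)) \<cdot> \<Phi> (U \<boxtimes> V) X V"
    using Assoc_natural_arr[of h "Ident C X" "Ident C V"] by simp
  have 3: "e \<cdot> (h \<star> Ident C (X \<boxtimes> V)) = h \<cdot> (Ident C (U \<boxtimes> V) \<star> e)"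
    by (simp add: slide_counit')
  have 4: "\<Phi> U (V \<boxtimes> X) V \<cdot> ((Ident C U \<star> d) \<star> Ident C V) = Ident C U \<star> (d \<star> Ident C V)"
    using Assoc_natural_arr[of "Ident C U" d "Ident C V"] by simp
  have 5: "(Ident C (U \<boxtimes> V) \<star> e) \<cdot> inv_arr C (\<Phi> U V (X \<boxtimes> V)) = Ident C U \<star> (Ident C V \<star> e)"
    using Assoc_inv_natural_arr[of "Ident C U" "Ident C V" e] by simp
  have 6: "(Ident C U \<star> (Ident C V \<star> e)) \<cdot> (Ident C U \<star> \<Phi> V X V) \<cdot> (Ident C U \<star> (d \<star> Ident C V))
      = Ident C (U \<boxtimes> V)"
    using arg_cong[OF zz, of "\<lambda>f. Ident C U \<star> f"] by (simp add: whisker_left)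
  have "e \<cdot> (mate U h \<star> Ident C V)
      = (e \<cdot> (h \<star> Ident C (X \<boxtimes> V))) \<cdot> (\<Phi> (U \<boxtimes> V) X V \<cdot> (inv_arr C (\<Phi> U V X) \<star> Ident C V))
        \<cdot> ((Ident C U \<star> d) \<star> Ident C V)"
    by (simp add: 1 2)
  also have "\<dots> = h \<cdot> ((Ident C (U \<boxtimes> V) \<star> e) \<cdot> inv_arr C (\<Phi> U V (X \<boxtimes> V)))
      \<cdot> (Ident C U \<star> \<Phi> V X V) \<cdot> (\<Phi> U (V \<boxtimes> X) V \<cdot> ((Ident C U \<star> d) \<star> Ident C V))"
    by (simp add: 3 pentagon_inv_left)
  also have "\<dots> = h"
    by (simp only: 4 5 6) simp
  finally show ?thesis .
qed

lemma unbend_bend: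
  assumes [simp]: "f \<in> Arr C" "Dom C f = Unit C" "Cod C f = V \<boxtimes> W" "W \<in> Obj C"
  shows "(Ident C V \<star> bend W f) \<cdot> d = f"
proof -
  have 1: "Ident C V \<star> bend W f = (Ident C V \<star> (e \<star> Ident C W))
      \<cdot> (Ident C V \<star> inv_arr C (\<Phi> X V W)) \<cdot> (Ident C V \<star> (Ident C X \<star> f))"
    by (simp add: whisker_left bend_def)
  have 2: "Ident C V \<star> (Ident C X \<star> f) = \<Phi> V X (V \<boxtimes> W) \<cdot> (Ident C (V \<boxtimes> X) \<star> f)"
    using Assoc_natural_arr[of "Ident C V" "Ident C X" f] by simp
  have 3: "(Ident C (V \<boxtimes> X) \<star> f) \<cdot> d = (d \<star> Ident C (V \<boxtimes> W)) \<cdot> f"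
    using slide_unit[of d f "V \<boxtimes> X" "V \<boxtimes> W" "Unit C"] by simp
  have 4: "inv_arr C (\<Phi> (V \<boxtimes> X) V W) \<cdot> (d \<star> Ident C (V \<boxtimes> W)) = (d \<star> Ident C V) \<star> Ident C W"
    using Assoc_inv_natural_arr[of d "Ident C V" "Ident C W"] by simp
  have 5: "(Ident C V \<star> (e \<star> Ident C W)) \<cdot> \<Phi> V (X \<boxtimes> V) W = (Ident C V \<star> e) \<star> Ident C W"
    using Assoc_natural_arr[of "Ident C V" e "Ident C W"] by simp
  have 6: "((Ident C V \<star> e) \<star> Ident C W) \<cdot> (\<Phi> V X V \<star> Ident C W) \<cdot> ((d \<star> Ident C V) \<star> Ident C W)
      = Ident C (V \<boxtimes> W)"
    using arg_cong[OF zz, of "\<lambda>f. f \<star> Ident C W"] by (simp add: whisker_right)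
  have "(Ident C V \<star> bend W f) \<cdot> d
      = (Ident C V \<star> (e \<star> Ident C W)) \<cdot> ((Ident C V \<star> inv_arr C (\<Phi> X V W)) \<cdot> \<Phi> V X (V \<boxtimes> W))
        \<cdot> ((Ident C (V \<boxtimes> X) \<star> f) \<cdot> d)"
    by (simp add: 1 2)
  also have "\<dots> = (((Ident C V \<star> (e \<star> Ident C W)) \<cdot> \<Phi> V (X \<boxtimes> V) W) \<cdot> (\<Phi> V X V \<star> Ident C W)
        \<cdot> (inv_arr C (\<Phi> (V \<boxtimes> X) V W) \<cdot> (d \<star> Ident C (V \<boxtimes> W)))) \<cdot> f"
    by (simp add: 3 pentagon_inv_right)
  also have "\<dots> = f"
    by (simp only: 4 5 6) simp
  finally show ?thesis .
qed

lemma ev_inject: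
  assumes "a \<in> Hom C U X" "b \<in> Hom C U X" "e \<cdot> (a \<star> Ident C V) = e \<cdot> (b \<star> Ident C V)"
  shows "a = b"
proof -
  have "a = mate U (e \<cdot> (a \<star> Ident C V))"
    using assms(1) by (intro mate_unmate[symmetric]) (simp_all add: Hom_iff)
  also have "\<dots> = mate U (e \<cdot> (b \<star> Ident C V))"
    by (simp only: assms(3))
  also have "\<dots> = b"
    using assms(2) by (intro mate_unmate) (simp_all add: Hom_iff)
  finally show ?thesis .
qed

lemma db_inject:
  assumes "a \<in> Hom C X W" "b \<in> Hom C X W" "(Ident C V \<star> a) \<cdot> d = (Ident C V \<star> b) \<cdot> d"
  shows "a = b"
proof -
  have "a = bend W ((Ident C V \<star> a) \<cdot> d)"
    using assms(1) by (intro bend_unbend[symmetric]) (simp_all add: Hom_iff)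
  also have "\<dots> = bend W ((Ident C V \<star> b) \<cdot> d)"
    by (simp only: assms(3))
  also have "\<dots> = b"
    using assms(2) by (intro bend_unbend) (simp_all add: Hom_iff)
  finally show ?thesis .
qed

lemma ex1_mate:
  assumes "h \<in> Hom C (U \<boxtimes> V) (Unit C)" "U \<in> Obj C"
  shows "\<exists>!g. g \<in> Hom C U X \<and> e \<cdot> (g \<star> Ident C V) = h"
proof (rule ex1I)
  have h: "h \<in> Arr C" "Dom C h = U \<boxtimes> V" "Cod C h = Unit C"
    using assms(1) by (simp_all add: Hom_iff)
  have mate: "mate U h \<in> Hom C U X" "e \<cdot> (mate U h \<star> Ident C V) = h"
    using ev_mate[OF h assms(2)] mate_simps[OF assms(2) h] by (simp_all only: Hom_iff simp_thms)
  then show "mate U h \<in> Hom C U X \<and> e \<cdot> (mate U h \<star> Ident C V) = h" ..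
  fix g assume g: "g \<in> Hom C U X \<and> e \<cdot> (g \<star> Ident C V) = h"
  then show "g = mate U h"
    by (intro ev_inject[OF conjunct1 mate(1)]) (simp_all only: mate(2) simp_thms)
qed

text \<open>
  The comparison of two duals is determined by the evaluations. It is the mate of \<open>e\<close> with respect
  to \<open>Y\<close>, and the formula for this mate is literally that for bending \<open>d'\<close> with respect to \<open>X\<close>;
  hence it also respects the coevaluations.
\<close>

lemma comparison_db:
  assumes "dual_pair C V Y e' d'"
    and g: "g \<in> Hom C X Y" "e' \<cdot> (g \<star> Ident C V) = e"
  shows "(Ident C V \<star> g) \<cdot> d = d'"
proof -
  interpret Y: dual_pair C V Y e' d' by fact
  have "g = Y.mate X e"
    using Y.mate_unmate[of g X] g by (simp add: Hom_iff)
  also have "\<dots> = bend Y d'"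
    by (simp add: Y.mate_def bend_def)
  finally show ?thesis
    using unbend_bend[of d' Y] by simp
qed

lemma comparison_iso:
  assumes "dual_pair C V Y e' d'"
    and g: "g \<in> Hom C X Y" "e' \<cdot> (g \<star> Ident C V) = e"
  shows "iso_arr C g"
proof -
  interpret Y: dual_pair C V Y e' d' by fact
  have [simp]: "g \<in> Arr C" "Dom C g = X" "Cod C g = Y" using g(1) by (auto simp: Hom_iff)
  define g' where "g' = mate Y e'"
  have [simp]: "g' \<in> Arr C" "Dom C g' = Y" "Cod C g' = X" by (simp_all add: g'_def)
  have e: "e \<cdot> (g' \<star> Ident C V) = e'" by (simp add: g'_def ev_mate)
  show ?thesis
  proof (rule iso_arrI[OF g(1)])
    show "g' \<in> Hom C Y X" by (simp add: Hom_iff)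
    have "e \<cdot> ((g' \<cdot> g) \<star> Ident C V) = e \<cdot> (Ident C X \<star> Ident C V)"
      using e g(2) by (simp add: whisker_right reassoc[OF e])
    then show "g' \<cdot> g = Ident C X"
      by (rule ev_inject[rotated -1]) (simp_all add: Hom_iff)
    have "e' \<cdot> ((g \<cdot> g') \<star> Ident C V) = e' \<cdot> (Ident C Y \<star> Ident C V)"
      using e g(2) by (simp add: whisker_right reassoc[OF g(2)])
    then show "g \<cdot> g' = Ident C Y"
      by (rule Y.ev_inject[rotated -1]) (simp_all add: Hom_iff)
  qed
qed

end

section \<open>Rigid categories\<close>

context rigid_monoidal_category begin

declare Dual_in_Obj [simp]

lemma ev_db_simps [simp]:
  assumes "V \<in> Obj C"
  shows "ev C V \<in> Arr C" "Dom C (ev C V) = Dual C V \<boxtimes> V" "Cod C (ev C V) = Unit C"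
    "db C V \<in> Arr C" "Dom C (db C V) = Unit C" "Cod C (db C V) = V \<boxtimes> Dual C V"
  using ev_in_Hom[OF assms] db_in_Hom[OF assms] by (auto simp: Hom_iff)

lemma dual_pair_Dual:
  assumes "V \<in> Obj C" shows "dual_pair C V (Dual C V) (ev C V) (db C V)"
  by unfold_locales (use assms zigzag zigzag_Dual ev_in_Hom db_in_Hom in auto)

lemma dual_arr_spec:
  assumes f: "f \<in> Hom C V W"
  shows "dual_arr C f \<in> Hom C (Dual C W) (Dual C V)"
    "ev C V \<cdot> (dual_arr C f \<star> Ident C V) = ev C W \<cdot> (Ident C (Dual C W) \<star> f)"
proof -
  have [simp]: "f \<in> Arr C" "Dom C f = V" "Cod C f = W" "V \<in> Obj C" "W \<in> Obj C"
    using f Dom_in_Obj[of f] Cod_in_Obj[of f] by (auto simp: Hom_iff)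
  interpret V: dual_pair C V "Dual C V" "ev C V" "db C V" by (rule dual_pair_Dual) simp
  have "\<exists>!g. g \<in> Hom C (Dual C W) (Dual C V)
      \<and> ev C V \<cdot> (g \<star> Ident C V) = ev C W \<cdot> (Ident C (Dual C W) \<star> f)"
    by (rule V.ex1_mate) (simp_all add: Hom_iff)
  from theI'[OF this] show "dual_arr C f \<in> Hom C (Dual C W) (Dual C V)"
    "ev C V \<cdot> (dual_arr C f \<star> Ident C V) = ev C W \<cdot> (Ident C (Dual C W) \<star> f)"
    unfolding dual_arr_def by simp_all
qed

lemma dual_arr_simps [simp]:
  assumes "f \<in> Arr C"
  shows "dual_arr C f \<in> Arr C" "Dom C (dual_arr C f) = Dual C (Cod C f)"
    "Cod C (dual_arr C f) = Dual C (Dom C f)"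
  using dual_arr_spec(1)[of f "Dom C f" "Cod C f"] assms by (auto simp: Hom_iff)

text \<open>
  This identity eliminates dual arrows: inserting the defining equation of \<open>f\<^sup>\<or>\<close> into the formula for
  mates exhibits \<open>f\<^sup>\<or>\<close> as \<open>A((f \<otimes> V\<^sup>\<or>) db\<^sub>V)\<close>, and \<open>A\<close> is inverse to \<open>g \<mapsto> (W \<otimes> g) db\<^sub>W\<close>.
\<close>

lemma dual_arr_db:
  assumes f: "f \<in> Hom C V W"
  shows "(Ident C W \<star> dual_arr C f) \<cdot> db C W = (f \<star> Ident C (Dual C V)) \<cdot> db C V"
proof -
  have [simp]: "f \<in> Arr C" "Dom C f = V" "Cod C f = W" "V \<in> Obj C" "W \<in> Obj C"
    using f Dom_in_Obj[of f] Cod_in_Obj[of f] by (auto simp: Hom_iff)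
  interpret V: dual_pair C V "Dual C V" "ev C V" "db C V" by (rule dual_pair_Dual) simp
  interpret W: dual_pair C W "Dual C W" "ev C W" "db C W" by (rule dual_pair_Dual) simp
  let ?V' = "Dual C V" and ?W' = "Dual C W"
  have 1: "((Ident C ?W' \<star> f) \<star> Ident C ?V') \<cdot> inv_arr C (\<Phi> ?W' V ?V')
      = inv_arr C (\<Phi> ?W' W ?V') \<cdot> (Ident C ?W' \<star> (f \<star> Ident C ?V'))"
    using Assoc_inv_natural_arr[of "Ident C ?W'" f "Ident C ?V'"] by simp
  have "dual_arr C f = V.mate ?W' (ev C V \<cdot> (dual_arr C f \<star> Ident C V))"
    by (rule V.mate_unmate[symmetric]) simp_all
  also have "\<dots> = (ev C W \<star> Ident C ?V') \<cdot> (((Ident C ?W' \<star> f) \<star> Ident C ?V')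
      \<cdot> inv_arr C (\<Phi> ?W' V ?V')) \<cdot> (Ident C ?W' \<star> db C V)"
    unfolding dual_arr_spec(2)[OF f] V.mate_def by (simp add: whisker_right)
  also have "\<dots> = W.bend ?V' ((f \<star> Ident C ?V') \<cdot> db C V)"
    unfolding 1 W.bend_def by (simp add: whisker_left)
  finally show ?thesis
    using W.unbend_bend[of "(f \<star> Ident C ?V') \<cdot> db C V" ?V'] by simp
qed

lemma A_map_simps [simp]:
  assumes "V \<in> Obj C" "W \<in> Obj C" "f \<in> Arr C" "Dom C f = Unit C" "Cod C f = V \<boxtimes> W"
  shows "A_map C V W f \<in> Arr C" "Dom C (A_map C V W f) = Dual C V" "Cod C (A_map C V W f) = W"
  using assms by (simp_all add: A_map_def)

lemma A_map_db:
  assumes "V \<in> Obj C" "W \<in> Obj C" "f \<in> Arr C" "Dom C f = Unit C" "Cod C f = V \<boxtimes> W"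
  shows "(Ident C V \<star> A_map C V W f) \<cdot> db C V = f"
proof -
  interpret V: dual_pair C V "Dual C V" "ev C V" "db C V" by (rule dual_pair_Dual) fact
  show ?thesis
    using V.unbend_bend[of f W] assms by (simp add: A_map_def V.bend_def)
qed

lemma A_map_eqI:
  assumes "V \<in> Obj C" "g \<in> Arr C" "Dom C g = Dual C V" "Cod C g = W"
    and "(Ident C V \<star> g) \<cdot> db C V = f"
  shows "A_map C V W f = g"
proof -
  interpret V: dual_pair C V "Dual C V" "ev C V" "db C V" by (rule dual_pair_Dual) fact
  show ?thesis
    using V.bend_unbend[of g W] assms by (simp add: A_map_def V.bend_def)
qed

lemma A_map_natural:
  assumes "V \<in> Obj C" "W \<in> Obj C" "f \<in> Arr C" "Dom C f = Unit C" "Cod C f = V \<boxtimes> W"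
    and h: "h \<in> Arr C" "Dom C h = W" "Cod C h = W'"
  shows "A_map C V W' ((Ident C V \<star> h) \<cdot> f) = h \<cdot> A_map C V W f"
  by (rule A_map_eqI) (use assms A_map_db[of V W f] in \<open>simp_all add: whisker_left\<close>)

end

section \<open>The rotation map of a pivotal category\<close>

context pivotal_monoidal_category begin

lemma piv_simps [simp]:
  assumes "V \<in> Obj C"
  shows "iso_arr C (piv C V)" "piv C V \<in> Arr C" "Dom C (piv C V) = V"
    "Cod C (piv C V) = Dual C (Dual C V)"
  using piv_natural_iso assms by (auto simp: natural_iso_def Hom_iff)

text \<open>
  The dual arrow in the definition of the rotation is removed with \<open>dual_arr_db\<close>. Linearity in \<open>f\<close>
  and naturality in \<open>W\<close> can be read off from the result.
\<close>

lemma E_map_eq: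
  assumes [simp]: "V \<in> Obj C" "W \<in> Obj C" "f \<in> Arr C" "Dom C f = Unit C" "Cod C f = V \<boxtimes> W"
  shows "E_map C V W f = (A_map C V W f \<star> inv_arr C (piv C V)) \<cdot> db C (Dual C V)"
proof -
  let ?A = "A_map C V W f" and ?V' = "Dual C V"
  have "E_map C V W f
      = (Ident C W \<star> inv_arr C (piv C V)) \<cdot> ((Ident C W \<star> dual_arr C ?A) \<cdot> db C W)"
    unfolding E_map_def A_inv_def T_map_def by (simp add: whisker_left)
  also have "(Ident C W \<star> dual_arr C ?A) \<cdot> db C W = (?A \<star> Ident C (Dual C ?V')) \<cdot> db C ?V'"
    by (rule dual_arr_db) (simp add: Hom_iff)
  also have "(Ident C W \<star> inv_arr C (piv C V)) \<cdot> (?A \<star> Ident C (Dual C ?V')) \<cdot> db C ?V'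
      = (?A \<star> inv_arr C (piv C V)) \<cdot> db C ?V'"
    by (subst reassoc[OF interchange]) simp_all
  finally show ?thesis .
qed

lemma E_map_simps [simp]:
  assumes "V \<in> Obj C" "W \<in> Obj C" "f \<in> Arr C" "Dom C f = Unit C" "Cod C f = V \<boxtimes> W"
  shows "E_map C V W f \<in> Arr C" "Dom C (E_map C V W f) = Unit C" "Cod C (E_map C V W f) = W \<boxtimes> V"
  using assms by (simp_all add: E_map_eq)

text \<open>
  Preservation of the pivotal structure is an equation for \<open>j\<close>, not for its inverse, so the
  rotation is compared across a functor in this form.
\<close>

lemma piv_E_map:
  assumes [simp]: "V \<in> Obj C" "W \<in> Obj C" "f \<in> Arr C" "Dom C f = Unit C" "Cod C f = V \<boxtimes> W"
  shows "(Ident C W \<star> piv C V) \<cdot> E_map C V W f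
    = (A_map C V W f \<star> Ident C (Dual C (Dual C V))) \<cdot> db C (Dual C V)"
  unfolding E_map_eq[OF assms] by (subst reassoc[OF interchange]) simp_all

lemma E_map_natural:
  assumes [simp]: "V \<in> Obj C" "W \<in> Obj C" "f \<in> Arr C" "Dom C f = Unit C" "Cod C f = V \<boxtimes> W"
    and h [simp]: "h \<in> Arr C" "Dom C h = W" "Cod C h = W'"
  shows "E_map C V W' ((Ident C V \<star> h) \<cdot> f) = (h \<star> Ident C V) \<cdot> E_map C V W f"
proof -
  have [simp]: "W' \<in> Obj C" using Cod_in_Obj[of h] by simp
  show ?thesis
    by (subst (1 2) E_map_eq) (simp_all add: A_map_natural[where W = W] reassoc[OF interchange])
qed

lemma tensor_pow_Obj [simp]: "V \<in> Obj C \<Longrightarrow> tensor_pow C V n \<in> Obj C"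
  by (induction n) simp_all

lemma assoc_pow_simps [simp]:
  assumes "V \<in> Obj C"
  shows "assoc_pow C V (Suc m) \<in> Arr C"
    "Dom C (assoc_pow C V (Suc m)) = tensor_pow C V m \<boxtimes> V"
    "Cod C (assoc_pow C V (Suc m)) = V \<boxtimes> tensor_pow C V m"
  using assms by (induction m) simp_all

lemma E_pow_simps [simp]:
  assumes "V \<in> Obj C" "f \<in> Arr C" "Dom C f = Unit C" "Cod C f = V \<boxtimes> tensor_pow C V m"
  shows "E_pow C V (Suc m) f \<in> Arr C" "Dom C (E_pow C V (Suc m) f) = Unit C"
    "Cod C (E_pow C V (Suc m) f) = V \<boxtimes> tensor_pow C V m"
  using assms by (simp_all add: E_pow_def)

end

section \<open>Monoidal functors preserve duals\<close>

context monoidal_functor begin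

abbreviation "\<F> \<equiv> FArr F"
abbreviation "\<F>o \<equiv> FObj F"
abbreviation "\<xi> \<equiv> FTensor F"

lemma FObj_in_Obj [simp]: "X \<in> Obj C \<Longrightarrow> \<F>o X \<in> Obj D"
  and FArr_Ident [simp]: "X \<in> Obj C \<Longrightarrow> \<F> (Ident C X) = Ident D (\<F>o X)"
  using is_functor by (auto simp: is_functor_def)

lemma FArr_simps [simp]:
  assumes "f \<in> Arr C"
  shows "\<F> f \<in> Arr D" "Dom D (\<F> f) = \<F>o (Dom C f)" "Cod D (\<F> f) = \<F>o (Cod C f)"
proof -
  have "\<F> f \<in> Hom D (\<F>o (Dom C f)) (\<F>o (Cod C f))"
    using is_functor assms unfolding is_functor_def by (auto simp: C.Hom_iff)
  then show "\<F> f \<in> Arr D" "Dom D (\<F> f) = \<F>o (Dom C f)" "Cod D (\<F> f) = \<F>o (Cod C f)"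
    by (auto simp: D.Hom_iff)
qed

lemma FArr_Comp:
  assumes "f \<in> Arr C" "g \<in> Arr C" "Dom C g = Cod C f"
  shows "\<F> (g \<cdot>\<^bsub>C\<^esub> f) = \<F> g \<cdot>\<^bsub>D\<^esub> \<F> f"
proof -
  have "f \<in> Hom C (Dom C f) (Cod C f)" "g \<in> Hom C (Cod C f) (Cod C g)"
    using assms by (auto simp: C.Hom_iff)
  then show ?thesis using is_functor unfolding is_functor_def by blast
qed

declare FObj_Unit [simp] FTensor_iso [simp] FTensor_Unit_left [simp] FTensor_Unit_right [simp]

lemma FTensor_simps [simp]:
  assumes "V \<in> Obj C" "W \<in> Obj C"
  shows "\<xi> V W \<in> Arr D" "Dom D (\<xi> V W) = \<F>o V \<boxtimes>\<^bsub>D\<^esub> \<F>o W" "Cod D (\<xi> V W) = \<F>o (V \<boxtimes>\<^bsub>C\<^esub> W)"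
  using FTensor_in_Hom[OF assms] by (auto simp: D.Hom_iff)

lemma FTensor_natural_arr:
  assumes "f \<in> Arr C" "g \<in> Arr C"
  shows "\<xi> (Cod C f) (Cod C g) \<cdot>\<^bsub>D\<^esub> (\<F> f \<star>\<^bsub>D\<^esub> \<F> g) = \<F> (f \<star>\<^bsub>C\<^esub> g) \<cdot>\<^bsub>D\<^esub> \<xi> (Dom C f) (Dom C g)"
  by (rule FTensor_natural) (use assms in \<open>simp_all add: C.Hom_iff\<close>)

lemma inv_FTensor_natural_arr:
  assumes "f \<in> Arr C" "g \<in> Arr C"
  shows "inv_arr D (\<xi> (Cod C f) (Cod C g)) \<cdot>\<^bsub>D\<^esub> \<F> (f \<star>\<^bsub>C\<^esub> g)
    = (\<F> f \<star>\<^bsub>D\<^esub> \<F> g) \<cdot>\<^bsub>D\<^esub> inv_arr D (\<xi> (Dom C f) (Dom C g))"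
    (is "?i' \<cdot>\<^bsub>D\<^esub> ?t = ?s \<cdot>\<^bsub>D\<^esub> ?i")
proof -
  have "?i' \<cdot>\<^bsub>D\<^esub> ?t = ?i' \<cdot>\<^bsub>D\<^esub> (?t \<cdot>\<^bsub>D\<^esub> \<xi> (Dom C f) (Dom C g)) \<cdot>\<^bsub>D\<^esub> ?i"
    using assms by simp
  also have "\<dots> = ?i' \<cdot>\<^bsub>D\<^esub> (\<xi> (Cod C f) (Cod C g) \<cdot>\<^bsub>D\<^esub> ?s) \<cdot>\<^bsub>D\<^esub> ?i"
    using assms by (simp only: FTensor_natural_arr)
  also have "\<dots> = ?s \<cdot>\<^bsub>D\<^esub> ?i"
    using assms by simp
  finally show ?thesis .
qed

text \<open>
  The coherence of \<open>\<xi>\<close>, solved for the inverse associator, which occurs in the second zigzag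
  identity.
\<close>

lemma FTensor_coherent_inv:
  assumes [simp]: "U \<in> Obj C" "V \<in> Obj C" "W \<in> Obj C"
  shows "(\<xi> U V \<star>\<^bsub>D\<^esub> Ident D (\<F>o W)) \<cdot>\<^bsub>D\<^esub> inv_arr D (\<Phi>\<^bsub>D\<^esub> (\<F>o U) (\<F>o V) (\<F>o W))
      \<cdot>\<^bsub>D\<^esub> (Ident D (\<F>o U) \<star>\<^bsub>D\<^esub> inv_arr D (\<xi> V W))
    = inv_arr D (\<xi> (U \<boxtimes>\<^bsub>C\<^esub> V) W) \<cdot>\<^bsub>D\<^esub> \<F> (inv_arr C (\<Phi>\<^bsub>C\<^esub> U V W)) \<cdot>\<^bsub>D\<^esub> \<xi> U (V \<boxtimes>\<^bsub>C\<^esub> W)"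
    (is "?s \<cdot>\<^bsub>D\<^esub> ?p' \<cdot>\<^bsub>D\<^esub> ?b' = ?r' \<cdot>\<^bsub>D\<^esub> ?q' \<cdot>\<^bsub>D\<^esub> ?a")
proof -
  let ?p = "\<Phi>\<^bsub>D\<^esub> (\<F>o U) (\<F>o V) (\<F>o W)" and ?q = "\<F> (\<Phi>\<^bsub>C\<^esub> U V W)"
  let ?r = "\<xi> (U \<boxtimes>\<^bsub>C\<^esub> V) W" and ?b = "Ident D (\<F>o U) \<star>\<^bsub>D\<^esub> \<xi> V W"
  have b: "?b \<cdot>\<^bsub>D\<^esub> ?b' = Ident D (\<F>o U \<boxtimes>\<^bsub>D\<^esub> \<F>o (V \<boxtimes>\<^bsub>C\<^esub> W))"
    by (simp add: D.interchange)
  have q: "?q' \<cdot>\<^bsub>D\<^esub> ?q = Ident D (\<F>o ((U \<boxtimes>\<^bsub>C\<^esub> V) \<boxtimes>\<^bsub>C\<^esub> W))"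
    using FArr_Comp[of "\<Phi>\<^bsub>C\<^esub> U V W" "inv_arr C (\<Phi>\<^bsub>C\<^esub> U V W)"] by simp
  have "?r' \<cdot>\<^bsub>D\<^esub> ?q' \<cdot>\<^bsub>D\<^esub> ?a = ?r' \<cdot>\<^bsub>D\<^esub> ?q' \<cdot>\<^bsub>D\<^esub> (?a \<cdot>\<^bsub>D\<^esub> ?b \<cdot>\<^bsub>D\<^esub> ?p) \<cdot>\<^bsub>D\<^esub> ?p' \<cdot>\<^bsub>D\<^esub> ?b'"
    by (simp add: b)
  also have "\<dots> = ?r' \<cdot>\<^bsub>D\<^esub> (?q' \<cdot>\<^bsub>D\<^esub> ?q) \<cdot>\<^bsub>D\<^esub> ?r \<cdot>\<^bsub>D\<^esub> ?s \<cdot>\<^bsub>D\<^esub> ?p' \<cdot>\<^bsub>D\<^esub> ?b'"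
    by (simp add: FTensor_coherent)
  also have "\<dots> = ?s \<cdot>\<^bsub>D\<^esub> ?p' \<cdot>\<^bsub>D\<^esub> ?b'"
    unfolding q by simp
  finally show ?thesis by (rule sym)
qed

text \<open>
  Coherence and naturality of \<open>\<xi>\<close> turn each zigzag composite in \<open>D\<close> into the image of the
  corresponding composite in \<open>C\<close>.
\<close>

lemma image_dual_pair:
  assumes "dual_pair C V X e d"
  shows "dual_pair D (\<F>o V) (\<F>o X) (\<F> e \<cdot>\<^bsub>D\<^esub> \<xi> X V) (inv_arr D (\<xi> V X) \<cdot>\<^bsub>D\<^esub> \<F> d)"
proof -
  interpret P: dual_pair C V X e d by fact
  show ?thesis
  proof unfold_locales
    show "\<F>o V \<in> Obj D" "\<F>o X \<in> Obj D" by simp_all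
    show "\<F> e \<cdot>\<^bsub>D\<^esub> \<xi> X V \<in> Hom D (\<F>o X \<boxtimes>\<^bsub>D\<^esub> \<F>o V) (Unit D)"
      "inv_arr D (\<xi> V X) \<cdot>\<^bsub>D\<^esub> \<F> d \<in> Hom D (Unit D) (\<F>o V \<boxtimes>\<^bsub>D\<^esub> \<F>o X)"
      by (simp_all add: D.Hom_iff)
    let ?V = "Ident D (\<F>o V)" and ?X = "Ident D (\<F>o X)"
    have e: "?V \<star>\<^bsub>D\<^esub> \<F> e = \<F> (Ident C V \<star>\<^bsub>C\<^esub> e) \<cdot>\<^bsub>D\<^esub> \<xi> V (X \<boxtimes>\<^bsub>C\<^esub> V)"
      using FTensor_natural_arr[of "Ident C V" e] by simp
    have d: "\<xi> (V \<boxtimes>\<^bsub>C\<^esub> X) V \<cdot>\<^bsub>D\<^esub> (\<F> d \<star>\<^bsub>D\<^esub> ?V) = \<F> (d \<star>\<^bsub>C\<^esub> Ident C V)"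
      using FTensor_natural_arr[of d "Ident C V"] by simp
    have inv: "(\<xi> V X \<star>\<^bsub>D\<^esub> ?V) \<cdot>\<^bsub>D\<^esub> (inv_arr D (\<xi> V X) \<star>\<^bsub>D\<^esub> ?V) = Ident D (\<F>o (V \<boxtimes>\<^bsub>C\<^esub> X) \<boxtimes>\<^bsub>D\<^esub> \<F>o V)"
      by (simp add: D.interchange)
    have "(?V \<star>\<^bsub>D\<^esub> (\<F> e \<cdot>\<^bsub>D\<^esub> \<xi> X V)) \<cdot>\<^bsub>D\<^esub> \<Phi>\<^bsub>D\<^esub> (\<F>o V) (\<F>o X) (\<F>o V)
          \<cdot>\<^bsub>D\<^esub> ((inv_arr D (\<xi> V X) \<cdot>\<^bsub>D\<^esub> \<F> d) \<star>\<^bsub>D\<^esub> ?V)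
        = \<F> (Ident C V \<star>\<^bsub>C\<^esub> e) \<cdot>\<^bsub>D\<^esub> (\<xi> V (X \<boxtimes>\<^bsub>C\<^esub> V) \<cdot>\<^bsub>D\<^esub> (?V \<star>\<^bsub>D\<^esub> \<xi> X V) \<cdot>\<^bsub>D\<^esub> \<Phi>\<^bsub>D\<^esub> (\<F>o V) (\<F>o X) (\<F>o V))
          \<cdot>\<^bsub>D\<^esub> (inv_arr D (\<xi> V X) \<star>\<^bsub>D\<^esub> ?V) \<cdot>\<^bsub>D\<^esub> (\<F> d \<star>\<^bsub>D\<^esub> ?V)"
      by (simp add: D.whisker_left D.whisker_right e)
    also have "\<dots> = \<F> (Ident C V \<star>\<^bsub>C\<^esub> e) \<cdot>\<^bsub>D\<^esub> \<F> (\<Phi>\<^bsub>C\<^esub> V X V) \<cdot>\<^bsub>D\<^esub> \<xi> (V \<boxtimes>\<^bsub>C\<^esub> X) V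
          \<cdot>\<^bsub>D\<^esub> ((\<xi> V X \<star>\<^bsub>D\<^esub> ?V) \<cdot>\<^bsub>D\<^esub> (inv_arr D (\<xi> V X) \<star>\<^bsub>D\<^esub> ?V)) \<cdot>\<^bsub>D\<^esub> (\<F> d \<star>\<^bsub>D\<^esub> ?V)"
      by (simp add: FTensor_coherent)
    also have "\<dots> = \<F> (Ident C V \<star>\<^bsub>C\<^esub> e) \<cdot>\<^bsub>D\<^esub> \<F> (\<Phi>\<^bsub>C\<^esub> V X V) \<cdot>\<^bsub>D\<^esub> \<F> (d \<star>\<^bsub>C\<^esub> Ident C V)"
      unfolding inv by (simp add: d)
    also have "\<dots> = \<F> ((Ident C V \<star>\<^bsub>C\<^esub> e) \<cdot>\<^bsub>C\<^esub> \<Phi>\<^bsub>C\<^esub> V X V \<cdot>\<^bsub>C\<^esub> (d \<star>\<^bsub>C\<^esub> Ident C V))"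
      by (simp add: FArr_Comp)
    also have "\<dots> = ?V"
      by (simp add: P.zz)
    finally show "(?V \<star>\<^bsub>D\<^esub> (\<F> e \<cdot>\<^bsub>D\<^esub> \<xi> X V)) \<cdot>\<^bsub>D\<^esub> \<Phi>\<^bsub>D\<^esub> (\<F>o V) (\<F>o X) (\<F>o V)
          \<cdot>\<^bsub>D\<^esub> ((inv_arr D (\<xi> V X) \<cdot>\<^bsub>D\<^esub> \<F> d) \<star>\<^bsub>D\<^esub> ?V) = ?V" .
    have e': "(\<F> e \<star>\<^bsub>D\<^esub> ?X) \<cdot>\<^bsub>D\<^esub> inv_arr D (\<xi> (X \<boxtimes>\<^bsub>C\<^esub> V) X) = \<F> (e \<star>\<^bsub>C\<^esub> Ident C X)"
      using inv_FTensor_natural_arr[of e "Ident C X"] by simp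
    have d': "\<xi> X (V \<boxtimes>\<^bsub>C\<^esub> X) \<cdot>\<^bsub>D\<^esub> (?X \<star>\<^bsub>D\<^esub> \<F> d) = \<F> (Ident C X \<star>\<^bsub>C\<^esub> d)"
      using FTensor_natural_arr[of "Ident C X" d] by simp
    have "((\<F> e \<cdot>\<^bsub>D\<^esub> \<xi> X V) \<star>\<^bsub>D\<^esub> ?X) \<cdot>\<^bsub>D\<^esub> inv_arr D (\<Phi>\<^bsub>D\<^esub> (\<F>o X) (\<F>o V) (\<F>o X))
          \<cdot>\<^bsub>D\<^esub> (?X \<star>\<^bsub>D\<^esub> (inv_arr D (\<xi> V X) \<cdot>\<^bsub>D\<^esub> \<F> d))
        = (\<F> e \<star>\<^bsub>D\<^esub> ?X) \<cdot>\<^bsub>D\<^esub> ((\<xi> X V \<star>\<^bsub>D\<^esub> ?X) \<cdot>\<^bsub>D\<^esub> inv_arr D (\<Phi>\<^bsub>D\<^esub> (\<F>o X) (\<F>o V) (\<F>o X))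
          \<cdot>\<^bsub>D\<^esub> (?X \<star>\<^bsub>D\<^esub> inv_arr D (\<xi> V X))) \<cdot>\<^bsub>D\<^esub> (?X \<star>\<^bsub>D\<^esub> \<F> d)"
      by (simp add: D.whisker_left D.whisker_right)
    also have "\<dots> = ((\<F> e \<star>\<^bsub>D\<^esub> ?X) \<cdot>\<^bsub>D\<^esub> inv_arr D (\<xi> (X \<boxtimes>\<^bsub>C\<^esub> V) X)) \<cdot>\<^bsub>D\<^esub> \<F> (inv_arr C (\<Phi>\<^bsub>C\<^esub> X V X))
          \<cdot>\<^bsub>D\<^esub> (\<xi> X (V \<boxtimes>\<^bsub>C\<^esub> X) \<cdot>\<^bsub>D\<^esub> (?X \<star>\<^bsub>D\<^esub> \<F> d))"
      by (simp add: FTensor_coherent_inv)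
    also have "\<dots> = \<F> ((e \<star>\<^bsub>C\<^esub> Ident C X) \<cdot>\<^bsub>C\<^esub> inv_arr C (\<Phi>\<^bsub>C\<^esub> X V X) \<cdot>\<^bsub>C\<^esub> (Ident C X \<star>\<^bsub>C\<^esub> d))"
      unfolding e' d' by (simp add: FArr_Comp)
    also have "\<dots> = ?X"
      by (simp add: P.zz_dual)
    finally show "((\<F> e \<cdot>\<^bsub>D\<^esub> \<xi> X V) \<star>\<^bsub>D\<^esub> ?X) \<cdot>\<^bsub>D\<^esub> inv_arr D (\<Phi>\<^bsub>D\<^esub> (\<F>o X) (\<F>o V) (\<F>o X))
          \<cdot>\<^bsub>D\<^esub> (?X \<star>\<^bsub>D\<^esub> (inv_arr D (\<xi> V X) \<cdot>\<^bsub>D\<^esub> \<F> d)) = ?X" .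
  qed
qed

end

section \<open>Pivotal functors commute with the rotation map\<close>

locale pivotal_functor =
  C: pivotal_monoidal_category C + D: pivotal_monoidal_category D + monoidal_functor C D F
  for C :: "('o1, 'm1, 'z1) pivotal_cat_scheme"
    and D :: "('o2, 'm2, 'z2) pivotal_cat_scheme"
    and F :: "('o1, 'm1, 'o2, 'm2) monoidal_fun" +
  assumes preserves_pivotal: "preserves_pivotal C D F"
begin

abbreviation "\<theta> \<equiv> duality_transf C D F"

abbreviation "lift V W f \<equiv> inv_arr D (\<xi> V W) \<cdot>\<^bsub>D\<^esub> \<F> f"

lemma duality_transf_spec:
  assumes X: "X \<in> Obj C"
  shows "\<theta> X \<in> Hom D (\<F>o (Dual C X)) (Dual D (\<F>o X))"
    "ev D (\<F>o X) \<cdot>\<^bsub>D\<^esub> (\<theta> X \<star>\<^bsub>D\<^esub> Ident D (\<F>o X)) = \<F> (ev C X) \<cdot>\<^bsub>D\<^esub> \<xi> (Dual C X) X"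
proof -
  interpret X: dual_pair D "\<F>o X" "Dual D (\<F>o X)" "ev D (\<F>o X)" "db D (\<F>o X)"
    by (rule D.dual_pair_Dual) (use X in simp)
  have "\<exists>!g. g \<in> Hom D (\<F>o (Dual C X)) (Dual D (\<F>o X))
      \<and> ev D (\<F>o X) \<cdot>\<^bsub>D\<^esub> (g \<star>\<^bsub>D\<^esub> Ident D (\<F>o X)) = \<F> (ev C X) \<cdot>\<^bsub>D\<^esub> \<xi> (Dual C X) X"
    by (rule X.ex1_mate) (use X in \<open>simp_all add: D.Hom_iff\<close>)
  from theI'[OF this] show "\<theta> X \<in> Hom D (\<F>o (Dual C X)) (Dual D (\<F>o X))"
    "ev D (\<F>o X) \<cdot>\<^bsub>D\<^esub> (\<theta> X \<star>\<^bsub>D\<^esub> Ident D (\<F>o X)) = \<F> (ev C X) \<cdot>\<^bsub>D\<^esub> \<xi> (Dual C X) X"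
    unfolding duality_transf_def by simp_all
qed

text \<open>
  The defining equation of \<open>\<theta>\<close> says that it is the comparison from the image of the chosen dual of
  \<open>X\<close> to the chosen dual of \<open>F(X)\<close>.
\<close>

lemma duality_transf_iso [simp]:
  assumes X: "X \<in> Obj C" shows "iso_arr D (\<theta> X)"
  by (rule dual_pair.comparison_iso[OF image_dual_pair[OF C.dual_pair_Dual[OF X]]
        D.dual_pair_Dual duality_transf_spec[OF X]]) (use X in simp)

lemma duality_transf_simps [simp]:
  assumes "X \<in> Obj C"
  shows "\<theta> X \<in> Arr D" "Dom D (\<theta> X) = \<F>o (Dual C X)" "Cod D (\<theta> X) = Dual D (\<F>o X)"
  using duality_transf_spec(1)[OF assms] by (auto simp: D.Hom_iff)

lemma duality_transf_db:
  assumes X: "X \<in> Obj C"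
  shows "(Ident D (\<F>o X) \<star>\<^bsub>D\<^esub> \<theta> X) \<cdot>\<^bsub>D\<^esub> lift X (Dual C X) (db C X) = db D (\<F>o X)"
  by (rule dual_pair.comparison_db[OF image_dual_pair[OF C.dual_pair_Dual[OF X]]
        D.dual_pair_Dual duality_transf_spec[OF X]]) (use X in simp)

text \<open>
  Both sides are arrows out of the dual \<open>F(V\<^sup>\<or>)\<close> of \<open>F(V)\<close>, and such an arrow \<open>g\<close> is determined by
  \<open>(F(V) \<otimes> g) d\<close>, where \<open>d\<close> is the coevaluation of that dual. Here both values are the transport of
  \<open>f\<close>: on the left by naturality of \<open>\<xi>\<close>, on the right because \<open>\<theta>\<close> sends \<open>d\<close> to \<open>db\<close>.
\<close>

lemma FArr_A_map:
  assumes [simp]: "V \<in> Obj C" "W \<in> Obj C" "f \<in> Arr C" "Dom C f = Unit C" "Cod C f = V \<boxtimes>\<^bsub>C\<^esub> W"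
  shows "\<F> (A_map C V W f) = A_map D (\<F>o V) (\<F>o W) (lift V W f) \<cdot>\<^bsub>D\<^esub> \<theta> V"
proof -
  let ?V = "Ident D (\<F>o V)" and ?V' = "Dual C V"
  let ?A = "A_map C V W f" and ?B = "A_map D (\<F>o V) (\<F>o W) (lift V W f)"
  interpret P: dual_pair D "\<F>o V" "\<F>o ?V'" "\<F> (ev C V) \<cdot>\<^bsub>D\<^esub> \<xi> ?V' V" "lift V ?V' (db C V)"
    by (rule image_dual_pair[OF C.dual_pair_Dual]) simp
  have nat: "inv_arr D (\<xi> V W) \<cdot>\<^bsub>D\<^esub> \<F> (Ident C V \<star>\<^bsub>C\<^esub> ?A) = (?V \<star>\<^bsub>D\<^esub> \<F> ?A) \<cdot>\<^bsub>D\<^esub> inv_arr D (\<xi> V ?V')"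
    using inv_FTensor_natural_arr[of "Ident C V" ?A] by simp
  have "(?V \<star>\<^bsub>D\<^esub> \<F> ?A) \<cdot>\<^bsub>D\<^esub> lift V ?V' (db C V) = ((?V \<star>\<^bsub>D\<^esub> \<F> ?A) \<cdot>\<^bsub>D\<^esub> inv_arr D (\<xi> V ?V')) \<cdot>\<^bsub>D\<^esub> \<F> (db C V)"
    by simp
  also have "\<dots> = inv_arr D (\<xi> V W) \<cdot>\<^bsub>D\<^esub> \<F> ((Ident C V \<star>\<^bsub>C\<^esub> ?A) \<cdot>\<^bsub>C\<^esub> db C V)"
    unfolding nat[symmetric] by (simp add: FArr_Comp)
  also have "\<dots> = lift V W f"
    by (simp add: C.A_map_db)
  also have "\<dots> = (?V \<star>\<^bsub>D\<^esub> ?B) \<cdot>\<^bsub>D\<^esub> db D (\<F>o V)"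
    by (simp add: D.A_map_db)
  also have "\<dots> = (?V \<star>\<^bsub>D\<^esub> ?B) \<cdot>\<^bsub>D\<^esub> (?V \<star>\<^bsub>D\<^esub> \<theta> V) \<cdot>\<^bsub>D\<^esub> lift V ?V' (db C V)"
    by (simp only: duality_transf_db[OF assms(1)])
  also have "\<dots> = (?V \<star>\<^bsub>D\<^esub> (?B \<cdot>\<^bsub>D\<^esub> \<theta> V)) \<cdot>\<^bsub>D\<^esub> lift V ?V' (db C V)"
    by (simp add: D.whisker_left)
  finally have "(?V \<star>\<^bsub>D\<^esub> \<F> ?A) \<cdot>\<^bsub>D\<^esub> lift V ?V' (db C V) = (?V \<star>\<^bsub>D\<^esub> (?B \<cdot>\<^bsub>D\<^esub> \<theta> V)) \<cdot>\<^bsub>D\<^esub> lift V ?V' (db C V)" .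
  then show ?thesis
    by (rule P.db_inject[rotated -1]) (simp_all add: D.Hom_iff)
qed

text \<open>
  The two sides are compared after composition with \<open>F(W) \<otimes> N\<close>, where the isomorphism
  \<open>N : F(V) \<rightarrow> F(V\<^sup>\<or>)\<^sup>\<or>\<close> is the common value of the two composites in the definition of a functor
  preserving the pivotal structure. One description of \<open>N\<close> cancels \<open>j\<close> in \<open>C\<close>, the other cancels \<open>j\<close> in
  \<open>D\<close>; both sides become \<open>(A(\<xi>\<^sup>-\<^sup>1 F(f)) \<theta>\<^sub>V \<otimes> id) db\<close>.
\<close>

lemma lift_E_map:
  assumes [simp]: "V \<in> Obj C" "W \<in> Obj C" "f \<in> Arr C" "Dom C f = Unit C" "Cod C f = V \<boxtimes>\<^bsub>C\<^esub> W"
  shows "lift W V (E_map C V W f) = E_map D (\<F>o V) (\<F>o W) (lift V W f)"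
proof -
  \<comment> \<open>Naming the two iterated duals keeps rewriting from expanding them.\<close>
  define X where "X = Dual C V"
  define Y where "Y = Dual C X"
  have X [simp]: "X \<in> Obj C" "Y \<in> Obj C" "Dual C V = X" "Dual C X = Y"
    by (simp_all add: X_def Y_def)
  let ?W = "Ident D (\<F>o W)" and ?A = "A_map C V W f" and ?E = "E_map C V W f"
  let ?B = "A_map D (\<F>o V) (\<F>o W) (lift V W f)"
  let ?FX' = "Dual D (\<F>o X)" and ?FV' = "Dual D (\<F>o V)"
  define N where "N = \<theta> X \<cdot>\<^bsub>D\<^esub> \<F> (piv C V)"
  have N: "N = dual_arr D (\<theta> V) \<cdot>\<^bsub>D\<^esub> piv D (\<F>o V)"
    using bspec[OF preserves_pivotal[unfolded preserves_pivotal_def] assms(1)] by (simp add: N_def)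
  have N_iso: "iso_arr D N"
  proof -
    have "iso_arr D (\<F> (piv C V))"
    proof (rule D.iso_arrI)
      show "\<F> (inv_arr C (piv C V)) \<cdot>\<^bsub>D\<^esub> \<F> (piv C V) = Ident D (\<F>o V)"
        by (simp flip: FArr_Comp)
      show "\<F> (piv C V) \<cdot>\<^bsub>D\<^esub> \<F> (inv_arr C (piv C V)) = Ident D (\<F>o Y)"
        by (simp flip: FArr_Comp)
    qed (simp_all add: D.Hom_iff)
    then show ?thesis
      unfolding N_def by (intro D.iso_comp) simp_all
  qed
  have N_simps [simp]: "N \<in> Arr D" "Dom D N = \<F>o V" "Cod D N = ?FX'"
    by (simp_all add: N_def)
  have nat1: "(?W \<star>\<^bsub>D\<^esub> \<F> (piv C V)) \<cdot>\<^bsub>D\<^esub> inv_arr D (\<xi> W V) = inv_arr D (\<xi> W Y) \<cdot>\<^bsub>D\<^esub> \<F> (Ident C W \<star>\<^bsub>C\<^esub> piv C V)"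
    using inv_FTensor_natural_arr[of "Ident C W" "piv C V"] by simp
  have nat2: "inv_arr D (\<xi> W Y) \<cdot>\<^bsub>D\<^esub> \<F> (?A \<star>\<^bsub>C\<^esub> Ident C Y) = (\<F> ?A \<star>\<^bsub>D\<^esub> Ident D (\<F>o Y)) \<cdot>\<^bsub>D\<^esub> inv_arr D (\<xi> X Y)"
    using inv_FTensor_natural_arr[of ?A "Ident C Y"] by simp
  have pE: "(Ident C W \<star>\<^bsub>C\<^esub> piv C V) \<cdot>\<^bsub>C\<^esub> ?E = (?A \<star>\<^bsub>C\<^esub> Ident C Y) \<cdot>\<^bsub>C\<^esub> db C X"
    using C.piv_E_map[of V W f] by simp
  have "(?W \<star>\<^bsub>D\<^esub> N) \<cdot>\<^bsub>D\<^esub> lift W V ?E = (?W \<star>\<^bsub>D\<^esub> \<theta> X) \<cdot>\<^bsub>D\<^esub> ((?W \<star>\<^bsub>D\<^esub> \<F> (piv C V)) \<cdot>\<^bsub>D\<^esub> inv_arr D (\<xi> W V)) \<cdot>\<^bsub>D\<^esub> \<F> ?E"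
    by (simp add: N_def D.whisker_left)
  also have "\<dots> = (?W \<star>\<^bsub>D\<^esub> \<theta> X) \<cdot>\<^bsub>D\<^esub> inv_arr D (\<xi> W Y) \<cdot>\<^bsub>D\<^esub> \<F> ((Ident C W \<star>\<^bsub>C\<^esub> piv C V) \<cdot>\<^bsub>C\<^esub> ?E)"
    unfolding nat1 by (simp add: FArr_Comp)
  also have "\<dots> = (?W \<star>\<^bsub>D\<^esub> \<theta> X) \<cdot>\<^bsub>D\<^esub> (inv_arr D (\<xi> W Y) \<cdot>\<^bsub>D\<^esub> \<F> (?A \<star>\<^bsub>C\<^esub> Ident C Y)) \<cdot>\<^bsub>D\<^esub> \<F> (db C X)"
    unfolding pE by (simp add: FArr_Comp)
  also have "\<dots> = ((?W \<star>\<^bsub>D\<^esub> \<theta> X) \<cdot>\<^bsub>D\<^esub> (\<F> ?A \<star>\<^bsub>D\<^esub> Ident D (\<F>o Y))) \<cdot>\<^bsub>D\<^esub> lift X Y (db C X)"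
    unfolding nat2 by simp
  also have "(?W \<star>\<^bsub>D\<^esub> \<theta> X) \<cdot>\<^bsub>D\<^esub> (\<F> ?A \<star>\<^bsub>D\<^esub> Ident D (\<F>o Y))
      = (\<F> ?A \<star>\<^bsub>D\<^esub> Ident D ?FX') \<cdot>\<^bsub>D\<^esub> (Ident D (\<F>o X) \<star>\<^bsub>D\<^esub> \<theta> X)"
    by (simp add: D.interchange)
  also have "\<dots> \<cdot>\<^bsub>D\<^esub> lift X Y (db C X) = (\<F> ?A \<star>\<^bsub>D\<^esub> Ident D ?FX') \<cdot>\<^bsub>D\<^esub> ((Ident D (\<F>o X) \<star>\<^bsub>D\<^esub> \<theta> X) \<cdot>\<^bsub>D\<^esub> lift X Y (db C X))"
    by simp
  also have "(Ident D (\<F>o X) \<star>\<^bsub>D\<^esub> \<theta> X) \<cdot>\<^bsub>D\<^esub> lift X Y (db C X) = db D (\<F>o X)"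
    using duality_transf_db[of X] by simp
  \<comment> \<open>Factor \<open>\<theta>\<^sub>V\<close> out of \<open>F(A(f))\<close> and trade it for its dual, which occurs in the second
    description of \<open>N\<close>.\<close>
  also have "(\<F> ?A \<star>\<^bsub>D\<^esub> Ident D ?FX') \<cdot>\<^bsub>D\<^esub> db D (\<F>o X)
      = (?B \<star>\<^bsub>D\<^esub> Ident D ?FX') \<cdot>\<^bsub>D\<^esub> ((\<theta> V \<star>\<^bsub>D\<^esub> Ident D ?FX') \<cdot>\<^bsub>D\<^esub> db D (\<F>o X))"
    by (simp add: FArr_A_map D.whisker_right)
  also have "(\<theta> V \<star>\<^bsub>D\<^esub> Ident D ?FX') \<cdot>\<^bsub>D\<^esub> db D (\<F>o X) = (Ident D ?FV' \<star>\<^bsub>D\<^esub> dual_arr D (\<theta> V)) \<cdot>\<^bsub>D\<^esub> db D ?FV'"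
    by (rule D.dual_arr_db[symmetric]) (simp add: D.Hom_iff)
  also have "(?B \<star>\<^bsub>D\<^esub> Ident D ?FX') \<cdot>\<^bsub>D\<^esub> \<dots> = ((?B \<star>\<^bsub>D\<^esub> Ident D ?FX') \<cdot>\<^bsub>D\<^esub> (Ident D ?FV' \<star>\<^bsub>D\<^esub> dual_arr D (\<theta> V))) \<cdot>\<^bsub>D\<^esub> db D ?FV'"
    by simp
  also have "(?B \<star>\<^bsub>D\<^esub> Ident D ?FX') \<cdot>\<^bsub>D\<^esub> (Ident D ?FV' \<star>\<^bsub>D\<^esub> dual_arr D (\<theta> V))
      = (?W \<star>\<^bsub>D\<^esub> dual_arr D (\<theta> V)) \<cdot>\<^bsub>D\<^esub> (?B \<star>\<^bsub>D\<^esub> Ident D (Dual D ?FV'))"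
    by (simp add: D.interchange)
  also have "\<dots> \<cdot>\<^bsub>D\<^esub> db D ?FV' = (?W \<star>\<^bsub>D\<^esub> dual_arr D (\<theta> V)) \<cdot>\<^bsub>D\<^esub> ((?B \<star>\<^bsub>D\<^esub> Ident D (Dual D ?FV')) \<cdot>\<^bsub>D\<^esub> db D ?FV')"
    by simp
  also have "(?B \<star>\<^bsub>D\<^esub> Ident D (Dual D ?FV')) \<cdot>\<^bsub>D\<^esub> db D ?FV'
      = (?W \<star>\<^bsub>D\<^esub> piv D (\<F>o V)) \<cdot>\<^bsub>D\<^esub> E_map D (\<F>o V) (\<F>o W) (lift V W f)"
    by (rule D.piv_E_map[symmetric]) simp_all
  also have "(?W \<star>\<^bsub>D\<^esub> dual_arr D (\<theta> V)) \<cdot>\<^bsub>D\<^esub> \<dots> = (?W \<star>\<^bsub>D\<^esub> N) \<cdot>\<^bsub>D\<^esub> E_map D (\<F>o V) (\<F>o W) (lift V W f)"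
    unfolding N by (simp add: D.whisker_left)
  finally have "(?W \<star>\<^bsub>D\<^esub> N) \<cdot>\<^bsub>D\<^esub> lift W V ?E = (?W \<star>\<^bsub>D\<^esub> N) \<cdot>\<^bsub>D\<^esub> E_map D (\<F>o V) (\<F>o W) (lift V W f)" .
  moreover have "iso_arr D (?W \<star>\<^bsub>D\<^esub> N)"
    by (rule D.iso_tensor[OF _ N_iso]) (simp add: D.iso_Ident)
  ultimately show ?thesis
    by (rule D.iso_cancel_left[rotated 5]) simp_all
qed

primrec tensor_pow_comparison :: "'o1 \<Rightarrow> nat \<Rightarrow> 'm2" where
  "tensor_pow_comparison V 0 = Ident D (Unit D)"
| "tensor_pow_comparison V (Suc n) =
    \<xi> V (tensor_pow C V n) \<cdot>\<^bsub>D\<^esub> (Ident D (\<F>o V) \<star>\<^bsub>D\<^esub> tensor_pow_comparison V n)"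

abbreviation "\<xi>p \<equiv> tensor_pow_comparison"

lemma tensor_pow_comparison_iso:
  assumes [simp]: "V \<in> Obj C"
  shows "iso_arr D (\<xi>p V n) \<and> Dom D (\<xi>p V n) = tensor_pow D (\<F>o V) n
    \<and> Cod D (\<xi>p V n) = \<F>o (tensor_pow C V n)"
proof (induction n)
  case 0
  show ?case by (simp add: D.iso_Ident)
next
  case (Suc n)
  then have [simp]: "iso_arr D (\<xi>p V n)" "Dom D (\<xi>p V n) = tensor_pow D (\<F>o V) n"
    "Cod D (\<xi>p V n) = \<F>o (tensor_pow C V n)"
    by simp_all
  have "iso_arr D (Ident D (\<F>o V) \<star>\<^bsub>D\<^esub> \<xi>p V n)"
    by (rule D.iso_tensor) (simp_all add: D.iso_Ident)
  then have "iso_arr D (\<xi>p V (Suc n))"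
    unfolding tensor_pow_comparison.simps by (rule D.iso_comp) simp_all
  then show ?case by simp
qed

lemma tensor_pow_comparison_simps [simp]:
  assumes "V \<in> Obj C"
  shows "iso_arr D (\<xi>p V n)" "\<xi>p V n \<in> Arr D" "Dom D (\<xi>p V n) = tensor_pow D (\<F>o V) n"
    "Cod D (\<xi>p V n) = \<F>o (tensor_pow C V n)"
  using tensor_pow_comparison_iso[OF assms, of n] by auto

text \<open>
  Each step of the recursion defining \<open>\<Phi>\<^sup>(\<^sup>n\<^sup>)\<close> adds one associator, which the coherence of \<open>\<xi>\<close> carries
  through \<open>F\<close>.
\<close>

lemma assoc_pow_comparison:
  assumes [simp]: "V \<in> Obj C"
  shows "\<xi>p V (Suc m) \<cdot>\<^bsub>D\<^esub> assoc_pow D (\<F>o V) (Suc m)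
    = \<F> (assoc_pow C V (Suc m)) \<cdot>\<^bsub>D\<^esub> \<xi> (tensor_pow C V m) V \<cdot>\<^bsub>D\<^esub> (\<xi>p V m \<star>\<^bsub>D\<^esub> Ident D (\<F>o V))"
proof (induction m)
  case 0
  show ?case by simp
next
  case (Suc m)
  let ?V = "Ident D (\<F>o V)" and ?T = "tensor_pow C V m" and ?T' = "tensor_pow D (\<F>o V) m"
  let ?p = "assoc_pow C V (Suc m)" and ?q = "assoc_pow D (\<F>o V) (Suc m)"
  have 1: "\<xi> V (V \<boxtimes>\<^bsub>C\<^esub> ?T) \<cdot>\<^bsub>D\<^esub> (?V \<star>\<^bsub>D\<^esub> \<F> ?p) = \<F> (Ident C V \<star>\<^bsub>C\<^esub> ?p) \<cdot>\<^bsub>D\<^esub> \<xi> V (?T \<boxtimes>\<^bsub>C\<^esub> V)"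
    using FTensor_natural_arr[of "Ident C V" ?p] by simp
  have 2: "(?V \<star>\<^bsub>D\<^esub> (\<xi>p V m \<star>\<^bsub>D\<^esub> ?V)) \<cdot>\<^bsub>D\<^esub> \<Phi>\<^bsub>D\<^esub> (\<F>o V) ?T' (\<F>o V)
      = \<Phi>\<^bsub>D\<^esub> (\<F>o V) (\<F>o ?T) (\<F>o V) \<cdot>\<^bsub>D\<^esub> ((?V \<star>\<^bsub>D\<^esub> \<xi>p V m) \<star>\<^bsub>D\<^esub> ?V)"
    using D.Assoc_natural_arr[of ?V "\<xi>p V m" ?V] by simp
  have "\<xi>p V (Suc (Suc m)) \<cdot>\<^bsub>D\<^esub> assoc_pow D (\<F>o V) (Suc (Suc m))
      = \<xi> V (V \<boxtimes>\<^bsub>C\<^esub> ?T) \<cdot>\<^bsub>D\<^esub> (?V \<star>\<^bsub>D\<^esub> (\<xi>p V (Suc m) \<cdot>\<^bsub>D\<^esub> ?q)) \<cdot>\<^bsub>D\<^esub> \<Phi>\<^bsub>D\<^esub> (\<F>o V) ?T' (\<F>o V)"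
    by (simp add: D.whisker_left del: assoc_pow.simps(2))
  also have "\<dots> = (\<xi> V (V \<boxtimes>\<^bsub>C\<^esub> ?T) \<cdot>\<^bsub>D\<^esub> (?V \<star>\<^bsub>D\<^esub> \<F> ?p)) \<cdot>\<^bsub>D\<^esub> (?V \<star>\<^bsub>D\<^esub> \<xi> ?T V)
      \<cdot>\<^bsub>D\<^esub> ((?V \<star>\<^bsub>D\<^esub> (\<xi>p V m \<star>\<^bsub>D\<^esub> ?V)) \<cdot>\<^bsub>D\<^esub> \<Phi>\<^bsub>D\<^esub> (\<F>o V) ?T' (\<F>o V))"
    unfolding Suc.IH by (simp add: D.whisker_left)
  also have "\<dots> = \<F> (Ident C V \<star>\<^bsub>C\<^esub> ?p) \<cdot>\<^bsub>D\<^esub> (\<xi> V (?T \<boxtimes>\<^bsub>C\<^esub> V) \<cdot>\<^bsub>D\<^esub> (?V \<star>\<^bsub>D\<^esub> \<xi> ?T V)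
      \<cdot>\<^bsub>D\<^esub> \<Phi>\<^bsub>D\<^esub> (\<F>o V) (\<F>o ?T) (\<F>o V)) \<cdot>\<^bsub>D\<^esub> ((?V \<star>\<^bsub>D\<^esub> \<xi>p V m) \<star>\<^bsub>D\<^esub> ?V)"
    unfolding 1 2 by simp
  also have "\<dots> = \<F> (Ident C V \<star>\<^bsub>C\<^esub> ?p) \<cdot>\<^bsub>D\<^esub> \<F> (\<Phi>\<^bsub>C\<^esub> V ?T V) \<cdot>\<^bsub>D\<^esub> \<xi> (V \<boxtimes>\<^bsub>C\<^esub> ?T) V
      \<cdot>\<^bsub>D\<^esub> (\<xi> V ?T \<star>\<^bsub>D\<^esub> ?V) \<cdot>\<^bsub>D\<^esub> ((?V \<star>\<^bsub>D\<^esub> \<xi>p V m) \<star>\<^bsub>D\<^esub> ?V)"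
    by (simp add: FTensor_coherent)
  also have "\<dots> = \<F> (assoc_pow C V (Suc (Suc m))) \<cdot>\<^bsub>D\<^esub> \<xi> (tensor_pow C V (Suc m)) V
      \<cdot>\<^bsub>D\<^esub> (\<xi>p V (Suc m) \<star>\<^bsub>D\<^esub> ?V)"
    by (simp add: FArr_Comp D.whisker_right)
  finally show ?case .
qed

definition transport :: "'o1 \<Rightarrow> nat \<Rightarrow> 'm1 \<Rightarrow> 'm2" where
  "transport V n f = inv_arr D (\<xi>p V n) \<cdot>\<^bsub>D\<^esub> \<F> f"

lemma transport_Hom:
  assumes "V \<in> Obj C" "f \<in> Hom C (Unit C) (tensor_pow C V n)"
  shows "transport V n f \<in> Hom D (Unit D) (tensor_pow D (\<F>o V) n)"
  using assms by (simp add: transport_def D.Hom_iff C.Hom_iff)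

text \<open>
  Only the first factor of \<open>V\<^sup>\<otimes>\<^sup>n = V \<otimes> V\<^sup>\<otimes>\<^sup>m\<close> is rotated. On the other side, the iterated comparison
  on \<open>V\<^sup>\<otimes>\<^sup>m\<close> is moved through the rotation by naturality, which reduces the claim to \<open>lift_E_map\<close>.
\<close>

lemma transport_E_pow:
  assumes V [simp]: "V \<in> Obj C" and f: "f \<in> Hom C (Unit C) (tensor_pow C V n)" and n: "n \<ge> 1"
  shows "transport V n (E_pow C V n f) = E_pow D (\<F>o V) n (transport V n f)"
proof -
  obtain m where m: "n = Suc m" using n by (cases n) auto
  have [simp]: "f \<in> Arr C" "Dom C f = Unit C" "Cod C f = V \<boxtimes>\<^bsub>C\<^esub> tensor_pow C V m"
    using f by (simp_all add: C.Hom_iff m)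
  let ?V = "Ident D (\<F>o V)" and ?T = "tensor_pow C V m" and ?T' = "tensor_pow D (\<F>o V) m"
  define g where "g = transport V (Suc m) f"
  have [simp]: "g \<in> Arr D" "Dom D g = Unit D" "Cod D g = \<F>o V \<boxtimes>\<^bsub>D\<^esub> ?T'"
    using transport_Hom[OF V f] by (simp_all add: D.Hom_iff m g_def)
  have lift: "(?V \<star>\<^bsub>D\<^esub> \<xi>p V m) \<cdot>\<^bsub>D\<^esub> g = lift V ?T f"
  proof -
    have "\<xi>p V (Suc m) \<cdot>\<^bsub>D\<^esub> g = \<F> f"
      unfolding g_def transport_def by (rule D.inv_arr_cancel(2)) (simp_all del: tensor_pow_comparison.simps)
    then have "inv_arr D (\<xi> V ?T) \<cdot>\<^bsub>D\<^esub> \<F> f = inv_arr D (\<xi> V ?T) \<cdot>\<^bsub>D\<^esub> \<xi>p V (Suc m) \<cdot>\<^bsub>D\<^esub> g"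
      by (simp only:)
    then show ?thesis by simp
  qed
  have "\<xi>p V (Suc m) \<cdot>\<^bsub>D\<^esub> E_pow D (\<F>o V) (Suc m) g
      = (\<xi>p V (Suc m) \<cdot>\<^bsub>D\<^esub> assoc_pow D (\<F>o V) (Suc m)) \<cdot>\<^bsub>D\<^esub> E_map D (\<F>o V) ?T' g"
    unfolding E_pow_def by simp
  also have "\<dots> = \<F> (assoc_pow C V (Suc m)) \<cdot>\<^bsub>D\<^esub> \<xi> ?T V
      \<cdot>\<^bsub>D\<^esub> ((\<xi>p V m \<star>\<^bsub>D\<^esub> ?V) \<cdot>\<^bsub>D\<^esub> E_map D (\<F>o V) ?T' g)"
    unfolding assoc_pow_comparison[OF V] by simp
  also have "(\<xi>p V m \<star>\<^bsub>D\<^esub> ?V) \<cdot>\<^bsub>D\<^esub> E_map D (\<F>o V) ?T' g = E_map D (\<F>o V) (\<F>o ?T) (lift V ?T f)"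
    unfolding lift[symmetric] by (rule D.E_map_natural[symmetric]) simp_all
  also have "\<dots> = lift ?T V (E_map C V ?T f)"
    by (rule lift_E_map[symmetric]) simp_all
  also have "\<F> (assoc_pow C V (Suc m)) \<cdot>\<^bsub>D\<^esub> \<xi> ?T V \<cdot>\<^bsub>D\<^esub> lift ?T V (E_map C V ?T f)
      = \<F> (E_pow C V (Suc m) f)"
    by (simp add: E_pow_def FArr_Comp)
  finally have "\<xi>p V (Suc m) \<cdot>\<^bsub>D\<^esub> E_pow D (\<F>o V) (Suc m) g = \<F> (E_pow C V (Suc m) f)" .
  then have "transport V (Suc m) (E_pow C V (Suc m) f)
      = inv_arr D (\<xi>p V (Suc m)) \<cdot>\<^bsub>D\<^esub> \<xi>p V (Suc m) \<cdot>\<^bsub>D\<^esub> E_pow D (\<F>o V) (Suc m) g"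
    unfolding transport_def by (simp only:)
  also have "\<dots> = E_pow D (\<F>o V) (Suc m) g"
    by (rule D.inv_arr_cancel(1)) (simp_all del: tensor_pow_comparison.simps)
  finally show ?thesis
    by (simp only: m g_def)
qed

end

section \<open>Traces of conjugate endomorphisms\<close>

lemma (in vectorspace) functional_lincomb:
  assumes \<phi>: "\<And>v. v \<in> carrier V \<Longrightarrow> \<phi> v \<in> carrier K"
    and add: "\<And>v w. \<lbrakk>v \<in> carrier V; w \<in> carrier V\<rbrakk> \<Longrightarrow> \<phi> (v \<oplus>\<^bsub>V\<^esub> w) = \<phi> v \<oplus>\<^bsub>K\<^esub> \<phi> w"
    and smult: "\<And>k v. \<lbrakk>k \<in> carrier K; v \<in> carrier V\<rbrakk> \<Longrightarrow> \<phi> (k \<odot>\<^bsub>V\<^esub> v) = k \<otimes>\<^bsub>K\<^esub> \<phi> v"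
    and A: "finite A" "A \<subseteq> carrier V" "a \<in> A \<rightarrow> carrier K"
  shows "\<phi> (lincomb a A) = (\<Oplus>\<^bsub>K\<^esub>v\<in>A. a v \<otimes>\<^bsub>K\<^esub> \<phi> v)"
  using A
proof (induction A)
  case empty
  have "\<phi> \<zero>\<^bsub>V\<^esub> = \<phi> (\<zero>\<^bsub>K\<^esub> \<odot>\<^bsub>V\<^esub> \<zero>\<^bsub>V\<^esub>)" by simp
  also have "\<dots> = \<zero>\<^bsub>K\<^esub>" using \<phi> by (subst smult) simp_all
  finally show ?case by (simp add: lincomb_def)
next
  case (insert x A)
  have eq: "lincomb a (insert x A) = a x \<odot>\<^bsub>V\<^esub> x \<oplus>\<^bsub>V\<^esub> lincomb a A"
    unfolding lincomb_def using insert.hyps insert.prems by (intro M.finsum_insert) auto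
  have "\<phi> (lincomb a (insert x A)) = \<phi> (a x \<odot>\<^bsub>V\<^esub> x) \<oplus>\<^bsub>K\<^esub> \<phi> (lincomb a A)"
    unfolding eq using insert.prems by (intro add) auto
  also have "\<phi> (a x \<odot>\<^bsub>V\<^esub> x) = a x \<otimes>\<^bsub>K\<^esub> \<phi> x"
    using insert.prems by (intro smult) auto
  also have "\<phi> (lincomb a A) = (\<Oplus>\<^bsub>K\<^esub>v\<in>A. a v \<otimes>\<^bsub>K\<^esub> \<phi> v)"
    using insert by auto
  also have "a x \<otimes>\<^bsub>K\<^esub> \<phi> x \<oplus>\<^bsub>K\<^esub> (\<Oplus>\<^bsub>K\<^esub>v\<in>A. a v \<otimes>\<^bsub>K\<^esub> \<phi> v)
      = (\<Oplus>\<^bsub>K\<^esub>v\<in>insert x A. a v \<otimes>\<^bsub>K\<^esub> \<phi> v)"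
    using insert.hyps insert.prems \<phi> by (intro R.finsum_insert[symmetric]) auto
  finally show ?case .
qed

context vectorspace
begin

lemma coords:
  assumes "finite B" "basis B" "v \<in> carrier V"
  shows "basis_coords K V B v \<in> B \<rightarrow>\<^sub>E carrier K" "lincomb (basis_coords K V B v) B = v"
proof -
  have "\<exists>!a. a \<in> B \<rightarrow>\<^sub>E carrier K \<and> lincomb a B = v"
    using assms basis_criterion[of B] by (auto simp: basis_def)
  from theI'[OF this] show "basis_coords K V B v \<in> B \<rightarrow>\<^sub>E carrier K"
    "lincomb (basis_coords K V B v) B = v"
    by (auto simp: basis_coords_def)
qed

lemma coord_closed:
  assumes "finite B" "basis B" "v \<in> carrier V" "b \<in> B"
  shows "basis_coords K V B v b \<in> carrier K"
  using coords(1)[OF assms(1-3)] assms(4) by auto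

lemma coord_lincomb:
  assumes "finite B" "basis B" "a \<in> B \<rightarrow> carrier K" "b \<in> B"
  shows "basis_coords K V B (lincomb a B) b = a b"
proof -
  have B: "B \<subseteq> carrier V" using assms(2) by (auto simp: basis_def)
  have a: "restrict a B \<in> B \<rightarrow>\<^sub>E carrier K" "lincomb (restrict a B) B = lincomb a B"
    using assms B by (auto intro!: lincomb_cong)
  have "\<exists>!a'. a' \<in> B \<rightarrow>\<^sub>E carrier K \<and> lincomb a' B = lincomb a B"
    using assms B basis_criterion[of B] by auto
  then have "basis_coords K V B (lincomb a B) = restrict a B"
    unfolding basis_coords_def by (rule the1_equality) (use a in auto)
  then show ?thesis using assms(4) by simp
qed

lemma coord_add:
  assumes B: "finite B" "basis B" and vw: "v \<in> carrier V" "w \<in> carrier V" and b: "b \<in> B"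
  shows "basis_coords K V B (v \<oplus>\<^bsub>V\<^esub> w) b = basis_coords K V B v b \<oplus>\<^bsub>K\<^esub> basis_coords K V B w b"
proof -
  have "v \<oplus>\<^bsub>V\<^esub> w = lincomb (\<lambda>x. basis_coords K V B v x \<oplus>\<^bsub>K\<^esub> basis_coords K V B w x) B"
    using B coords[OF B vw(1)] coords[OF B vw(2)] by (subst lincomb_sum) (auto simp: basis_def)
  then show ?thesis
    using coord_lincomb[OF B, of "\<lambda>x. basis_coords K V B v x \<oplus>\<^bsub>K\<^esub> basis_coords K V B w x"] b
      coord_closed[OF B vw(1)] coord_closed[OF B vw(2)] by auto
qed

lemma coord_smult:
  assumes B: "finite B" "basis B" and v: "k \<in> carrier K" "v \<in> carrier V" and b: "b \<in> B"
  shows "basis_coords K V B (k \<odot>\<^bsub>V\<^esub> v) b = k \<otimes>\<^bsub>K\<^esub> basis_coords K V B v b"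
proof -
  have "k \<odot>\<^bsub>V\<^esub> v = lincomb (\<lambda>x. k \<otimes>\<^bsub>K\<^esub> basis_coords K V B v x) B"
    using B v coords[OF B v(2)] by (subst lincomb_smult) (auto simp: basis_def)
  then show ?thesis
    using coord_lincomb[OF B, of "\<lambda>x. k \<otimes>\<^bsub>K\<^esub> basis_coords K V B v x"] b v
      coord_closed[OF B v(2)] by auto
qed

end

lemma coord_linear_image:
  assumes g: "linear_map K W V g" and B: "finite B" "vectorspace.basis K V B"
    and C: "finite C" "vectorspace.basis K W C" and w: "w \<in> carrier W" and b: "b \<in> B"
  shows "basis_coords K V B (g w) b
    = (\<Oplus>\<^bsub>K\<^esub>c\<in>C. basis_coords K W C w c \<otimes>\<^bsub>K\<^esub> basis_coords K V B (g c) b)"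
proof -
  interpret V: vectorspace K V using g by (rule linear_map.axioms(2))
  interpret W: vectorspace K W using g by (rule linear_map.axioms(1))
  interpret g: mod_hom K W V g using g by (rule linear_map.axioms(3))
  let ?a = "basis_coords K W C w"
  have C': "C \<subseteq> carrier W" using C(2) by (auto simp: W.basis_def)
  have "W.lincomb ?a C = w" and a: "?a \<in> C \<rightarrow> carrier K"
    using W.coords[OF C w] by auto
  then have "basis_coords K V B (g w) b = basis_coords K V B (g (W.lincomb ?a C)) b" by simp
  also have "\<dots> = (\<Oplus>\<^bsub>K\<^esub>c\<in>C. ?a c \<otimes>\<^bsub>K\<^esub> basis_coords K V B (g c) b)"
    using B C C' a b
    by (intro W.functional_lincomb[where \<phi> = "\<lambda>w. basis_coords K V B (g w) b"])
      (auto simp: V.coord_add V.coord_smult V.coord_closed)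
  finally show ?thesis .
qed

text \<open>
  The bases behind the two traces are chosen independently. Expanding both traces in the matrices
  of \<open>f\<close> and \<open>g\<close> with respect to these bases gives the same double sum, up to the order of
  summation.
\<close>

lemma linear_trace_commute:
  assumes f: "linear_map K V W f" and g: "linear_map K W V g"
    and fin: "vectorspace.fin_dim K V" "vectorspace.fin_dim K W"
  shows "linear_trace K V (\<lambda>v. g (f v)) = linear_trace K W (\<lambda>w. f (g w))"
proof -
  interpret V: vectorspace K V using f by (rule linear_map.axioms(1))
  interpret W: vectorspace K W using f by (rule linear_map.axioms(2))
  interpret f: mod_hom K V W f using f by (rule linear_map.axioms(3))
  interpret g: mod_hom K W V g using g by (rule linear_map.axioms(3))
  define B where "B = (SOME B. finite B \<and> vectorspace.basis K V B)"
  define C where "C = (SOME C. finite C \<and> vectorspace.basis K W C)"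
  have B: "finite B" "vectorspace.basis K V B"
    unfolding B_def using someI_ex[OF V.finite_basis_exists[OF fin(1)]] by auto
  have C: "finite C" "vectorspace.basis K W C"
    unfolding C_def using someI_ex[OF W.finite_basis_exists[OF fin(2)]] by auto
  have BC: "B \<subseteq> carrier V" "C \<subseteq> carrier W"
    using B C by (auto simp: V.basis_def W.basis_def)
  let ?F = "\<lambda>b c. basis_coords K W C (f b) c"
  let ?G = "\<lambda>c b. basis_coords K V B (g c) b"
  have F: "?F b c \<in> carrier K" and G: "?G c b \<in> carrier K" if "b \<in> B" "c \<in> C" for b c
    using W.coord_closed[OF C, of "f b" c] V.coord_closed[OF B, of "g c" b] that BC by auto
  have "linear_trace K V (\<lambda>v. g (f v)) = (\<Oplus>\<^bsub>K\<^esub>b\<in>B. \<Oplus>\<^bsub>K\<^esub>c\<in>C. ?F b c \<otimes>\<^bsub>K\<^esub> ?G c b)"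
    unfolding linear_trace_def Let_def B_def[symmetric]
    using coord_linear_image[OF g B C] BC F G
    by (intro V.R.finsum_cong') (auto intro!: V.R.finsum_closed)
  also have "\<dots> = (\<Oplus>\<^bsub>K\<^esub>c\<in>C. \<Oplus>\<^bsub>K\<^esub>b\<in>B. ?F b c \<otimes>\<^bsub>K\<^esub> ?G c b)"
    using B C F G by (intro V.R.finsum_finsum_swap) auto
  also have "\<dots> = (\<Oplus>\<^bsub>K\<^esub>c\<in>C. \<Oplus>\<^bsub>K\<^esub>b\<in>B. ?G c b \<otimes>\<^bsub>K\<^esub> ?F b c)"
    using F G by (intro V.R.finsum_cong' refl) (auto intro!: V.R.finsum_closed simp: V.R.m_comm)
  also have "\<dots> = linear_trace K W (\<lambda>w. f (g w))"
    unfolding linear_trace_def Let_def C_def[symmetric]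
    using coord_linear_image[OF f C B] BC F G
    by (intro V.R.finsum_cong'[symmetric]) (auto intro!: V.R.finsum_closed)
  finally show ?thesis .
qed

lemma linear_map_iff:
  "linear_map K V W f \<longleftrightarrow> vectorspace K V \<and> vectorspace K W \<and> f \<in> module_hom K V W"
  by (auto simp: linear_map_def mod_hom_def mod_hom_axioms_def vectorspace_def)

lemma linear_map_comp:
  assumes "linear_map K U V f" "linear_map K V W g"
  shows "linear_map K U W (\<lambda>x. g (f x))"
  using assms by (auto simp: linear_map_iff module_hom_def Pi_def)

lemma linear_map_id: "vectorspace K V \<Longrightarrow> linear_map K V V (\<lambda>x. x)"
  by (simp add: linear_map_iff module_hom_def)

lemma linear_map_funpow:
  assumes "linear_map K V V f"
  shows "linear_map K V V (f ^^ n)"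
proof (induction n)
  case 0
  then show ?case using assms linear_map_id by (auto simp: linear_map_iff id_def)
next
  case (Suc n)
  from linear_map_comp[OF this assms] show ?case by (simp add: comp_def)
qed

lemma linear_map_cong:
  assumes f: "linear_map K V W f" and eq: "\<And>v. v \<in> carrier V \<Longrightarrow> g v = f v"
  shows "linear_map K V W g"
proof -
  interpret V: vectorspace K V using f by (simp add: linear_map_iff)
  have "f \<in> module_hom K V W" using f by (simp add: linear_map_iff)
  then have "g \<in> module_hom K V W"
    by (auto simp: module_hom_def eq Pi_def)
  then show ?thesis using f by (simp add: linear_map_iff)
qed

lemma linear_map_inv_into:
  assumes f: "linear_map K V W f" and bij: "bij_betw f (carrier V) (carrier W)"
  shows "linear_map K W V (inv_into (carrier V) f)"
proof -
  interpret V: vectorspace K V using f by (simp add: linear_map_iff)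
  interpret W: vectorspace K W using f by (simp add: linear_map_iff)
  let ?g = "inv_into (carrier V) f"
  have f': "f \<in> module_hom K V W" using f by (simp add: linear_map_iff)
  have g: "?g w \<in> carrier V" "f (?g w) = w" if "w \<in> carrier W" for w
    using bij that by (auto simp: bij_betw_def intro: inv_into_into f_inv_into_f)
  have gI: "?g w = v" if "v \<in> carrier V" "f v = w" for v w
    using bij that by (auto simp: bij_betw_def)
  have "?g \<in> module_hom K W V"
    unfolding module_hom_def
    using g by (auto intro!: gI simp: module_hom_add[OF f'] module_hom_smult[OF f'])
  then show ?thesis using f by (simp add: linear_map_iff)
qed

lemma (in vectorspace) linear_trace_cong:
  assumes "fin_dim" "\<And>v. v \<in> carrier V \<Longrightarrow> T v = T' v"
    and "\<And>v. v \<in> carrier V \<Longrightarrow> T v \<in> carrier V"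
  shows "linear_trace K V T = linear_trace K V T'"
proof -
  define B where "B = (SOME B. finite B \<and> basis B)"
  have B: "finite B" "basis B"
    unfolding B_def using someI_ex[OF finite_basis_exists[OF assms(1)]] by auto
  show ?thesis
    unfolding linear_trace_def Let_def B_def[symmetric]
  proof (rule R.finsum_cong')
    have b: "b \<in> carrier V" if "b \<in> B" for b using B that by (auto simp: basis_def)
    show "(\<lambda>b. basis_coords K V B (T' b) b) \<in> B \<rightarrow> carrier K"
      using b assms(3) by (auto intro!: coord_closed[OF B] simp flip: assms(2))
    show "basis_coords K V B (T b) b = basis_coords K V B (T' b) b" if "b \<in> B" for b
      using b[OF that] assms(2) by simp
  qed simp
qed

text \<open>
  For an invertible \<open>S\<close> the endomorphisms \<open>T\<close> and \<open>S T S\<^sup>-\<^sup>1\<close> are the two products of \<open>T S\<^sup>-\<^sup>1\<close>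
  and \<open>S\<close>.
\<close>

lemma linear_trace_conjugate:
  assumes T: "linear_map K V V T" and S: "linear_map K V W S"
    and bij: "bij_betw S (carrier V) (carrier W)"
    and ST: "\<And>v. v \<in> carrier V \<Longrightarrow> S (T v) = T' (S v)"
    and fin: "vectorspace.fin_dim K V" "vectorspace.fin_dim K W"
  shows "linear_trace K V T = linear_trace K W T'"
proof -
  interpret V: vectorspace K V using S by (simp add: linear_map_iff)
  interpret W: vectorspace K W using S by (simp add: linear_map_iff)
  let ?R = "inv_into (carrier V) S"
  have R: "?R w \<in> carrier V" "S (?R w) = w" if "w \<in> carrier W" for w
    using bij that by (auto simp: bij_betw_def intro: inv_into_into f_inv_into_f)
  have RS: "?R (S v) = v" if "v \<in> carrier V" for v
    using bij that by (auto simp: bij_betw_def)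
  have T_closed: "T v \<in> carrier V" and S_closed: "S v \<in> carrier W" if "v \<in> carrier V" for v
    using T S that by (auto simp: linear_map_iff module_hom_def)
  have "linear_trace K V T = linear_trace K V (\<lambda>v. T (?R (S v)))"
    by (rule V.linear_trace_cong) (simp_all add: fin RS T_closed)
  also have "\<dots> = linear_trace K W (\<lambda>w. S (T (?R w)))"
    by (rule linear_trace_commute[OF S linear_map_comp[OF linear_map_inv_into[OF S bij] T] fin])
  also have "\<dots> = linear_trace K W T'"
    by (rule W.linear_trace_cong) (simp_all add: fin R T_closed S_closed, simp add: ST R)
  finally show ?thesis .
qed

section \<open>Equivalences are fully faithful\<close>

text \<open>
  Naturality of \<open>\<eta>\<close> makes \<open>F\<close> faithful and naturality of \<open>\<epsilon>\<close> makes the quasi-inverse \<open>G\<close> faithful. An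
  arrow \<open>g\<close> in \<open>D\<close> is the image of \<open>\<eta>\<^sup>-\<^sup>1 G(g) \<eta>\<close>, since \<open>G\<close> agrees on these two arrows.
\<close>

lemma equivalence_bij_betw_Hom:
  assumes C: "category C" and D: "category D" and equiv: "is_equivalence C D Fo Fa"
    and XY: "X \<in> Obj C" "Y \<in> Obj C"
  shows "bij_betw Fa (Hom C X Y) (Hom D (Fo X) (Fo Y))"
proof -
  interpret C: category C by fact
  interpret D: category D by fact
  from equiv obtain Go Ga \<eta> \<epsilon> where F: "is_functor C D Fo Fa" and G: "is_functor D C Go Ga"
    and \<eta>: "natural_iso C C (\<lambda>X. X) (\<lambda>f. f) (Go \<circ> Fo) (Ga \<circ> Fa) \<eta>"
    and \<epsilon>: "natural_iso D D (Fo \<circ> Go) (Fa \<circ> Ga) (\<lambda>X. X) (\<lambda>f. f) \<epsilon>"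
    unfolding is_equivalence_def by blast
  have F_Hom: "Fa f \<in> Hom D (Fo A) (Fo B)" if "f \<in> Hom C A B" for f A B
    using F that unfolding is_functor_def by blast
  have G_Hom: "Ga g \<in> Hom C (Go A) (Go B)" if "g \<in> Hom D A B" for g A B
    using G that unfolding is_functor_def by blast
  have F_Obj: "Fo A \<in> Obj D" if "A \<in> Obj C" for A
    using F that unfolding is_functor_def by blast
  have \<eta>_iso: "\<eta> A \<in> Hom C A (Go (Fo A))" "iso_arr C (\<eta> A)" if "A \<in> Obj C" for A
    using \<eta> that unfolding natural_iso_def by auto
  have \<epsilon>_iso: "\<epsilon> B \<in> Hom D (Fo (Go B)) B" "iso_arr D (\<epsilon> B)" if "B \<in> Obj D" for B
    using \<epsilon> that unfolding natural_iso_def by auto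
  have \<eta>_nat: "\<eta> B \<cdot>\<^bsub>C\<^esub> f = Ga (Fa f) \<cdot>\<^bsub>C\<^esub> \<eta> A" if "f \<in> Hom C A B" for f A B
    using \<eta> that unfolding natural_iso_def by auto
  have \<epsilon>_nat: "\<epsilon> B \<cdot>\<^bsub>D\<^esub> Fa (Ga g) = g \<cdot>\<^bsub>D\<^esub> \<epsilon> A" if "g \<in> Hom D A B" for g A B
    using \<epsilon> that unfolding natural_iso_def by auto
  have F_inject: "f = f'" if f: "f \<in> Hom C A B" and f': "f' \<in> Hom C A B" and eq: "Fa f = Fa f'"
    for f f' A B
  proof -
    have B: "B \<in> Obj C" using f C.Cod_in_Obj by (auto simp: C.Hom_iff)
    \<comment> \<open>Both composites equal \<open>G(F(f)) \<cdot> \<eta>\<close>.\<close>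
    have "\<eta> B \<cdot>\<^bsub>C\<^esub> f = \<eta> B \<cdot>\<^bsub>C\<^esub> f'"
      by (simp only: \<eta>_nat[OF f] \<eta>_nat[OF f'] eq)
    then show ?thesis
      by (rule C.iso_cancel_left[rotated 5])
        (use f f' \<eta>_iso[OF B] in \<open>simp_all add: C.Hom_iff\<close>)
  qed
  have G_inject: "g = g'" if g: "g \<in> Hom D A B" and g': "g' \<in> Hom D A B" and eq: "Ga g = Ga g'"
    for g g' A B
  proof -
    have A: "A \<in> Obj D" using g D.Dom_in_Obj by (auto simp: D.Hom_iff)
    have "g \<cdot>\<^bsub>D\<^esub> \<epsilon> A = g' \<cdot>\<^bsub>D\<^esub> \<epsilon> A"
      by (simp only: \<epsilon>_nat[OF g, symmetric] \<epsilon>_nat[OF g', symmetric] eq)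
    then have "(g \<cdot>\<^bsub>D\<^esub> \<epsilon> A) \<cdot>\<^bsub>D\<^esub> inv_arr D (\<epsilon> A) = (g' \<cdot>\<^bsub>D\<^esub> \<epsilon> A) \<cdot>\<^bsub>D\<^esub> inv_arr D (\<epsilon> A)"
      by (simp only:)
    then show ?thesis
      using g g' \<epsilon>_iso[OF A] by (simp add: D.Hom_iff)
  qed
  have F_surj: "g \<in> Fa ` Hom C X Y" if g: "g \<in> Hom D (Fo X) (Fo Y)" for g
  proof -
    define f where "f = inv_arr C (\<eta> Y) \<cdot>\<^bsub>C\<^esub> Ga g \<cdot>\<^bsub>C\<^esub> \<eta> X"
    have [simp]: "iso_arr C (\<eta> X)" "Dom C (\<eta> X) = X" "Cod C (\<eta> X) = Go (Fo X)"
      "iso_arr C (\<eta> Y)" "Dom C (\<eta> Y) = Y" "Cod C (\<eta> Y) = Go (Fo Y)"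
      using \<eta>_iso[OF XY(1)] \<eta>_iso[OF XY(2)] by (simp_all add: C.Hom_iff)
    have [simp]: "Ga g \<in> Arr C" "Dom C (Ga g) = Go (Fo X)" "Cod C (Ga g) = Go (Fo Y)"
      using G_Hom[OF g] by (simp_all add: C.Hom_iff)
    have f: "f \<in> Hom C X Y"
      by (simp add: f_def C.Hom_iff)
    have GF: "Ga (Fa f) \<in> Hom C (Go (Fo X)) (Go (Fo Y))"
      by (intro G_Hom F_Hom f)
    have "Ga (Fa f) \<cdot>\<^bsub>C\<^esub> \<eta> X = \<eta> Y \<cdot>\<^bsub>C\<^esub> f"
      by (rule \<eta>_nat[OF f, symmetric])
    also have "\<dots> = Ga g \<cdot>\<^bsub>C\<^esub> \<eta> X"
      by (simp add: f_def)
    finally have "(Ga (Fa f) \<cdot>\<^bsub>C\<^esub> \<eta> X) \<cdot>\<^bsub>C\<^esub> inv_arr C (\<eta> X) = (Ga g \<cdot>\<^bsub>C\<^esub> \<eta> X) \<cdot>\<^bsub>C\<^esub> inv_arr C (\<eta> X)"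
      by (simp only:)
    then have "Ga (Fa f) = Ga g"
      using GF by (simp add: C.Hom_iff)
    then have "Fa f = g"
      by (rule G_inject[OF F_Hom[OF f] g])
    then show ?thesis
      using f by blast
  qed
  show ?thesis
    unfolding bij_betw_def inj_on_def using F_inject F_surj F_Hom by blast
qed

section \<open>Linearity of the rotation map\<close>

context linear_pivotal_monoidal_category begin

lemma carrier_Hom_space [simp]: "carrier (Hom_space C X Y) = Hom C X Y"
  by (simp add: Hom_space_def)

lemma A_map_linear:
  assumes [simp]: "V \<in> Obj C" "W \<in> Obj C"
  shows "linear_map K (Hom_space C (Unit C) (V \<boxtimes> W)) (Hom_space C (Dual C V) W) (A_map C V W)"
proof -
  let ?X = "Dual C V"
  have 1: "linear_map K (Hom_space C (Unit C) (V \<boxtimes> W)) (Hom_space C ?X (?X \<boxtimes> (V \<boxtimes> W)))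
      (\<lambda>f. Ident C ?X \<star> f)"
    using Tensor_linear_right[of "Ident C ?X" ?X ?X "Unit C" "V \<boxtimes> W"] by (simp add: Hom_iff)
  have 2: "linear_map K (Hom_space C ?X (?X \<boxtimes> (V \<boxtimes> W))) (Hom_space C ?X ((?X \<boxtimes> V) \<boxtimes> W))
      (\<lambda>f. inv_arr C (\<Phi> ?X V W) \<cdot> f)"
    by (rule Comp_linear_right) (simp_all add: Hom_iff)
  have 3: "linear_map K (Hom_space C ?X ((?X \<boxtimes> V) \<boxtimes> W)) (Hom_space C ?X W)
      (\<lambda>f. (ev C V \<star> Ident C W) \<cdot> f)"
    by (rule Comp_linear_right) (simp_all add: Hom_iff)
  show ?thesis
    unfolding A_map_def by (rule linear_map_comp[OF linear_map_comp[OF 1 2] 3])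
qed

lemma E_map_linear:
  assumes [simp]: "V \<in> Obj C" "W \<in> Obj C"
  shows "linear_map K (Hom_space C (Unit C) (V \<boxtimes> W)) (Hom_space C (Unit C) (W \<boxtimes> V)) (E_map C V W)"
proof -
  let ?X = "Dual C V" and ?Y = "Dual C (Dual C V)"
  have 1: "linear_map K (Hom_space C ?X W) (Hom_space C (?X \<boxtimes> ?Y) (W \<boxtimes> V))
      (\<lambda>g. g \<star> inv_arr C (piv C V))"
    by (rule Tensor_linear_left) (simp_all add: Hom_iff)
  have 2: "linear_map K (Hom_space C (?X \<boxtimes> ?Y) (W \<boxtimes> V)) (Hom_space C (Unit C) (W \<boxtimes> V))
      (\<lambda>h. h \<cdot> db C ?X)"
    by (rule Comp_linear_left) (simp_all add: Hom_iff)
  show ?thesis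
    by (rule linear_map_cong[OF linear_map_comp[OF linear_map_comp[OF A_map_linear 1] 2]])
      (simp_all add: Hom_iff E_map_eq)
qed

lemma E_pow_linear:
  assumes [simp]: "V \<in> Obj C" and n: "n \<ge> 1"
  shows "linear_map K (Hom_space C (Unit C) (tensor_pow C V n))
    (Hom_space C (Unit C) (tensor_pow C V n)) (E_pow C V n)"
proof -
  obtain m where m: "n = Suc m" using n by (cases n) auto
  have 1: "linear_map K (Hom_space C (Unit C) (tensor_pow C V m \<boxtimes> V))
      (Hom_space C (Unit C) (tensor_pow C V n)) (\<lambda>f. assoc_pow C V n \<cdot> f)"
    by (rule Comp_linear_right) (simp_all add: Hom_iff m)
  have 2: "linear_map K (Hom_space C (Unit C) (tensor_pow C V n))
      (Hom_space C (Unit C) (tensor_pow C V m \<boxtimes> V)) (E_map C V (tensor_pow C V m))"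
    using E_map_linear[of V "tensor_pow C V m"] by (simp add: m)
  show ?thesis
    by (rule linear_map_cong[OF linear_map_comp[OF 2 1]]) (simp add: E_pow_def m)
qed

end

section \<open>Invariance of the indicators\<close>

theorem corollary4p4:
  fixes K :: "('k, 'r) ring_scheme"
    and C :: "('o1, 'm1, 'k, 'z1) linear_pivotal_cat_scheme"
    and D :: "('o2, 'm2, 'k, 'z2) linear_pivotal_cat_scheme"
    and F :: "('o1, 'm1, 'o2, 'm2) monoidal_fun"
    and n r :: nat and V :: 'o1
  assumes "linear_pivotal_monoidal_category K C"
    and "linear_pivotal_monoidal_category K D"
    and "monoidal_functor C D F"
    and "is_equivalence C D (FObj F) (FArr F)"
    and "linear_functor K C D F"
    and "preserves_pivotal C D F"
    and "\<And>X. X \<in> Obj C \<Longrightarrow> vectorspace.fin_dim K (Hom_space C (Unit C) X)"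
    and "\<And>Y. Y \<in> Obj D \<Longrightarrow> vectorspace.fin_dim K (Hom_space D (Unit D) Y)"
    and "V \<in> Obj C" and "n \<ge> 1" and "r \<ge> 1"
  shows "fs_indicator K C n r V = fs_indicator K D n r (FObj F V)"
proof -
  interpret C: linear_pivotal_monoidal_category K C by fact
  interpret D: linear_pivotal_monoidal_category K D by fact
  interpret F: monoidal_functor C D F by fact
  interpret F: pivotal_functor C D F by unfold_locales fact
  note [simp] = \<open>V \<in> Obj C\<close>
  let ?I = "Unit C" and ?J = "Unit D"
  let ?T = "tensor_pow C V n" and ?U = "tensor_pow D (FObj F V) n"
  let ?S = "F.transport V n" and ?x = "F.tensor_pow_comparison V n"
  let ?E = "E_pow C V n" and ?E' = "E_pow D (FObj F V) n"
  have E_closed: "(?E ^^ r) f \<in> Hom C ?I ?T" if "f \<in> Hom C ?I ?T" for f r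
    using linear_map_funpow[OF C.E_pow_linear[OF \<open>V \<in> Obj C\<close> \<open>n \<ge> 1\<close>], of r] that
    by (auto simp: linear_map_iff module_hom_def)
  have F_bij: "bij_betw (FArr F) (Hom C ?I ?T) (Hom D ?J (FObj F ?T))"
    using equivalence_bij_betw_Hom[OF C.category_axioms D.category_axioms assms(4), of ?I ?T]
    by simp
  have x_bij: "bij_betw (\<lambda>g. inv_arr D ?x \<cdot>\<^bsub>D\<^esub> g) (Hom D ?J (FObj F ?T)) (Hom D ?J ?U)"
    by (rule bij_betw_byWitness[where f' = "\<lambda>g. ?x \<cdot>\<^bsub>D\<^esub> g"]) (auto simp: D.Hom_iff)
  have S_bij: "bij_betw ?S (Hom C ?I ?T) (Hom D ?J ?U)"
    using bij_betw_trans[OF F_bij x_bij] by (simp add: F.transport_def[abs_def] comp_def)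
  have "linear_map K (Hom_space C ?I ?T) (Hom_space D ?J (FObj F ?T)) (FArr F)"
    using assms(5) unfolding linear_functor_def by (metis C.Unit_in_Obj C.tensor_pow_Obj F.FObj_Unit \<open>V \<in> Obj C\<close>)
  moreover have "linear_map K (Hom_space D ?J (FObj F ?T)) (Hom_space D ?J ?U) (\<lambda>g. inv_arr D ?x \<cdot>\<^bsub>D\<^esub> g)"
    by (rule D.Comp_linear_right) (simp_all add: D.Hom_iff)
  ultimately have S_linear: "linear_map K (Hom_space C ?I ?T) (Hom_space D ?J ?U) ?S"
    unfolding F.transport_def[abs_def] by (rule linear_map_comp)
  have S_E: "?S ((?E ^^ r) f) = (?E' ^^ r) (?S f)" if f: "f \<in> Hom C ?I ?T" for f r
  proof (induction r)
    case 0
    show ?case by simp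
  next
    case (Suc r)
    then show ?case
      using F.transport_E_pow[OF \<open>V \<in> Obj C\<close> E_closed[OF f, of r] \<open>n \<ge> 1\<close>] by simp
  qed
  show ?thesis
    unfolding fs_indicator_def
  proof (rule linear_trace_conjugate)
    show "linear_map K (Hom_space C ?I ?T) (Hom_space C ?I ?T) (?E ^^ r)"
      by (intro linear_map_funpow C.E_pow_linear) (use assms in simp_all)
    show "bij_betw ?S (carrier (Hom_space C ?I ?T)) (carrier (Hom_space D ?J ?U))"
      using S_bij by simp
    show "vectorspace.fin_dim K (Hom_space C ?I ?T)" "vectorspace.fin_dim K (Hom_space D ?J ?U)"
      by (intro assms(7,8); simp)+
  qed (use S_linear S_E in simp_all)
qed

end
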